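(* Let $p,q\ge 0$ be integers and $n=p+q\geq 1$. The following subspaces of the real Clifford algebra $\mathcal{C}\!\ell^{\mathbb R}(p,q)$ are closed with respect to the commutator $U,V\mapsto[U,V]=UV-VU$ and hence form Lie algebras: 1) for $n\ge1$: $\widehat{\mathbf 0}$; 2) for $n\ge1$: $\widehat{\mathbf n}$; 3) for $n\ge2$: $\widehat{\mathbf 1}\oplus\widehat{\mathbf 2}$; 4) for $n\ge3$ (if $n=2$ it is the same as item 2): $\widehat{\mathbf 2}$; 5) for $n\ge4$ (if $n=2,3$ it is the same as item 3): $\widehat{\mathbf 1}\oplus\widehat{\mathbf 2}\oplus\ldots\oplus\widehat{\mathbf n}$ for even $n$; $\widehat{\mathbf 1}\oplus\widehat{\mathbf 2}\oplus\ldots\oplus\widehat{\mathbf{n-1}}$ for odd $n$; 6) for $n\ge4$: $\widehat{\mathbf 2}\oplus\widehat{\mathbf{n-1}}$; 7) for $n\ge5$: $\widehat{\mathbf 2}\oplus\widehat{\mathbf{n-2}}$; 8) for $n\ge6$ (if $n=5$ it is the same as item 5): $\widehat{\mathbf 1}\oplus\widehat{\mathbf 2}\oplus\widehat{\mathbf{n-2}}\oplus\widehat{\mathbf{n-1}}$ for odd $n$; $\widehat{\mathbf 1}\oplus\widehat{\mathbf 2}\oplus\widehat{\mathbf{n-1}}\oplus\widehat{\mathbf n}$ for even $n$; 9) for $n\ge6$ (if $n=2,3$ it is the same as item 4, if $n=4$ as item 6, if $n=5$ as item 7): $\widehat{\mathbf 2}\oplus\widehat{\mathbf 3}\oplus\widehat{\mathbf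 6}\oplus\widehat{\mathbf 7}\oplus\widehat{\mathbf{10}}\oplus\widehat{\mathbf{11}}\oplus\ldots\oplus\widehat{\mathbf k}=\overline{\mathbf{23}}$ (all ranks $\equiv 2,3 \pmod 4$ up to $k$), where $n=k+1,k+2$ for odd $k$ and $n=k,k+1$ for even $k$; 10) for $n\ge7$ (if $n=3,4$ it is the same as item 4, if $n=5$ as item 6, if $n=6$ as item 7): $\widehat{\mathbf 2}\oplus\widehat{\mathbf 4}\oplus\widehat{\mathbf 6}\oplus\ldots\oplus\widehat{\mathbf k}=\overline{\mathbf{02}}$ (all positive even ranks up to the even number $k$), where $n=k+1,k+2$; 11) for $n\ge8$ (if $n=2,3,4,5$ it is the same as item 3, if $n=6,7$ as item 8): $\widehat{\mathbf 1}\oplus\widehat{\mathbf 2}\oplus\widehat{\mathbf 5}\oplus\widehat{\mathbf 6}\oplus\widehat{\mathbf 9}\oplus\widehat{\mathbf{10}}\oplus\ldots\oplus\widehat{\mathbf k}=\overline{\mathbf{12}}$ (all ranks $\equiv 1,2\pmod 4$ up to $k$), where $n=k,k+1,k+2,k+3$ for even $k$ (so $k\equiv2\pmod 4$); 12) for $n\ge9$ (if $n=3,4,5,6$ it is the same as item 4, if $n=7$ as item 6, if $n=8$ as item 7): $\widehat{\mathbf 2}\oplus\widehat{\mathbf 6}\oplus\widehat{\mathbf{10}}\oplus\ldots\oplus\widehat{\mathbf k}=\overline{\mathbf 2}$ (all ranks $\equiv2\pmod4$ up to $k$), where $n=k+1,k+2,k+3,k+4$ and $k\equiv 2\pmod 4$.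 (In all items, equalities with subspaces of quaternion types are understood up to elements of rank $0$ and rank $n$.) Besides, the direct sums of all listed subalgebras with $\widehat{\mathbf 0}$ are also Lie subalgebras for any $n$; the direct sums of all listed subalgebras with $\widehat{\mathbf n}$ are Lie subalgebras for odd $n$; and for even $n$, adding $\widehat{\mathbf n}$ to those listed subalgebras that consist of elements of even ranks also gives Lie subalgebras.
   Context: $\mathcal{C}\!\ell^{\mathbb R}(p,q)$ is the real Clifford algebra with identity $e$ and generators $e^1,\dots,e^n$, $n=p+q$, satisfying $e^ae^b+e^be^a=2\eta^{ab}e$, where $\eta$ is diagonal with $p$ entries $+1$ followed by $q$ entries $-1$. The $2^n$ elements $e$ and $e^{a_1\ldots a_k}=e^{a_1}\cdots e^{a_k}$ ($a_1<\dots<a_k$, $1\le k\le n$) form a basis. $\widehat{\mathbf k}=\mathcal{C}\!\ell^{\mathbb R}_k(p,q)$ is the real span of the basis elements with $k$ indices (rank $k$; $\widehat{\mathbf 0}=\mathbb R e$). For $k\in\{0,1,2,3\}$, $\overline{\mathbf k}=\bigoplus_{j\equiv k\,(\mathrm{mod}\,4),\,0\le j\le n}\widehat{\mathbf j}$ (subspaces of quaternion type), and $\overline{\mathbf{kl}}=\overline{\mathbf k}\oplus\overline{\mathbf l}$. An equality $S=T$ "up to elements of rank $0$ and rank $n$" means $S+\widehat{\mathbf 0}+\widehat{\mathbf n}=T+\widehat{\mathbf 0}+\widehat{\mathbf n}$. "Direct sum with $\widehat{\mathbf 0}$ (or $\widehat{\mathbf n}$)" means the sum of subspaces, which is direct whenever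 the listed subalgebra does not already contain that summand. *)

theory Defs
  imports "HOL-Analysis.Analysis" "HOL-Library.Set_Algebras"
begin

section \<open>Real Clifford algebras of signature \<open>(p, q)\<close>\<close>

definition clifford_metric :: "nat \<Rightarrow> nat \<Rightarrow> nat \<Rightarrow> real" where
  "clifford_metric p a b = (if a \<noteq> b then 0 else if a \<le> p then 1 else - 1)"

text \<open>The product of the generators with indices in the finite set \<open>A\<close>, in increasing order
  of the indices; the empty product is the identity.\<close>

definition basis_elt :: "(nat \<Rightarrow> 'a::real_algebra_1) \<Rightarrow> nat set \<Rightarrow> 'a" where
  "basis_elt g A = prod_list (map g (sorted_list_of_set A))"

text \<open>The Clifford algebra is presented inside an arbitrary real unital algebra, as the span of
  the \<open>2 ^ (p + q)\<close> ordered products of its generators \<open>g 1, \<dots>, g (p + q)\<close>; the case that it is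
  the whole type is included.\<close>

definition clifford_generators :: "nat \<Rightarrow> nat \<Rightarrow> (nat \<Rightarrow> 'a::real_algebra_1) \<Rightarrow> bool" where
  "clifford_generators p q g \<longleftrightarrow>
     (\<forall>a\<in>{1..p+q}. \<forall>b\<in>{1..p+q}. g a * g b + g b * g a = (2 * clifford_metric p a b) *\<^sub>R 1) \<and>
     inj_on (basis_elt g) (Pow {1..p+q}) \<and>
     independent (basis_elt g ` Pow {1..p+q})"

definition clifford_algebra :: "nat \<Rightarrow> (nat \<Rightarrow> 'a::real_algebra_1) \<Rightarrow> 'a set" where
  "clifford_algebra n g = span (basis_elt g ` Pow {1..n})"

definition rank_space :: "nat \<Rightarrow> (nat \<Rightarrow> 'a::real_algebra_1) \<Rightarrow> nat \<Rightarrow> 'a set" where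
  "rank_space n g k = span (basis_elt g ` {A. A \<subseteq> {1..n} \<and> card A = k})"

text \<open>Sums of subspaces are elementwise sums of sets; the empty sum is \<open>{0}\<close>.\<close>

definition rank_sum :: "nat \<Rightarrow> (nat \<Rightarrow> 'a::real_algebra_1) \<Rightarrow> nat set \<Rightarrow> 'a set" where
  "rank_sum n g K = (\<Sum>k\<in>K. rank_space n g k)"

definition quaternion_type :: "nat \<Rightarrow> (nat \<Rightarrow> 'a::real_algebra_1) \<Rightarrow> nat \<Rightarrow> 'a set" where
  "quaternion_type n g k = rank_sum n g {j. j \<le> n \<and> j mod 4 = k mod 4}"

definition direct_family :: "'i set \<Rightarrow> ('i \<Rightarrow> 'a::real_vector set) \<Rightarrow> bool" where
  "direct_family I W \<longleftrightarrow>
     (\<forall>w. (\<forall>i\<in>I. w i \<in> W i) \<and> (\<Sum>i\<in>I. w i) = 0 \<longrightarrow> (\<forall>i\<in>I. w i = 0))"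

definition eq_up_to_0_n :: "nat \<Rightarrow> (nat \<Rightarrow> 'a::real_algebra_1) \<Rightarrow> 'a set \<Rightarrow> 'a set \<Rightarrow> bool" where
  "eq_up_to_0_n n g S T \<longleftrightarrow>
     S + rank_space n g 0 + rank_space n g n = T + rank_space n g 0 + rank_space n g n"


section \<open>Lie algebras of Clifford algebra elements\<close>

definition commutator :: "'a::ring \<Rightarrow> 'a \<Rightarrow> 'a" where
  "commutator U V = U * V - V * U"

definition lie_algebra_on :: "'a::real_vector set \<Rightarrow> ('a \<Rightarrow> 'a \<Rightarrow> 'a) \<Rightarrow> bool" where
  "lie_algebra_on S br \<longleftrightarrow>
     subspace S \<and>
     (\<forall>U\<in>S. \<forall>V\<in>S. br U V \<in> S) \<and>
     (\<forall>U\<in>S. \<forall>V\<in>S. \<forall>W\<in>S. \<forall>c. br (U + V) W = br U W + br V W \<and> br (c *\<^sub>R U) W = c *\<^sub>R br U W) \<and>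
     (\<forall>U\<in>S. \<forall>V\<in>S. \<forall>W\<in>S. \<forall>c. br W (U + V) = br W U + br W V \<and> br W (c *\<^sub>R U) = c *\<^sub>R br W U) \<and>
     (\<forall>U\<in>S. br U U = 0) \<and>
     (\<forall>U\<in>S. \<forall>V\<in>S. \<forall>W\<in>S. br U (br V W) + br V (br W U) + br W (br U V) = 0)"

definition lie_subalgebra :: "nat \<Rightarrow> (nat \<Rightarrow> 'a::real_algebra_1) \<Rightarrow> 'a set \<Rightarrow> bool" where
  "lie_subalgebra n g S \<longleftrightarrow> S \<subseteq> clifford_algebra n g \<and> lie_algebra_on S commutator"

text \<open>\<open>S + T\<close> is a Lie subalgebra, and the sum is direct unless \<open>S\<close> already contains \<open>T\<close>.\<close>

definition lie_extension :: "nat \<Rightarrow> (nat \<Rightarrow> 'a::real_algebra_1) \<Rightarrow> 'a set \<Rightarrow> 'a set \<Rightarrow> bool" where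
  "lie_extension n g S T \<longleftrightarrow> lie_subalgebra n g (S + T) \<and> (T \<subseteq> S \<or> S \<inter> T = {0})"

text \<open>What is asserted of each individual listed subspace: it is a Lie subalgebra, and so are its
  extensions by the elements of rank \<open>0\<close>, and by those of rank \<open>n\<close> if \<open>n\<close> is odd or \<open>S\<close> consists of
  elements of even ranks.\<close>

definition listed_lie_subalgebra :: "nat \<Rightarrow> (nat \<Rightarrow> 'a::real_algebra_1) \<Rightarrow> 'a set \<Rightarrow> bool" where
  "listed_lie_subalgebra n g S \<longleftrightarrow>
     lie_subalgebra n g S \<and>
     lie_extension n g S (rank_space n g 0) \<and>
     (odd n \<longrightarrow> lie_extension n g S (rank_space n g n)) \<and>
     (even n \<and> S \<subseteq> rank_sum n g {j. j \<le> n \<and> even j} \<longrightarrow>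
        lie_extension n g S (rank_space n g n))"


section \<open>The last rank \<open>k\<close> in the sums over ranks in given residue classes\<close>

definition last_rank_23 :: "nat \<Rightarrow> nat \<Rightarrow> bool" where
  "last_rank_23 n k \<longleftrightarrow>
     k mod 4 \<in> {2, 3} \<and> (odd k \<longrightarrow> n \<in> {k + 1, k + 2}) \<and> (even k \<longrightarrow> n \<in> {k, k + 1})"

definition last_rank_02 :: "nat \<Rightarrow> nat \<Rightarrow> bool" where
  "last_rank_02 n k \<longleftrightarrow> k \<ge> 2 \<and> even k \<and> n \<in> {k + 1, k + 2}"

definition last_rank_12 :: "nat \<Rightarrow> nat \<Rightarrow> bool" where
  "last_rank_12 n k \<longleftrightarrow> k mod 4 = 2 \<and> n \<in> {k, k + 1, k + 2, k + 3}"

definition last_rank_2 :: "nat \<Rightarrow> nat \<Rightarrow> bool" where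
  "last_rank_2 n k \<longleftrightarrow> k mod 4 = 2 \<and> n \<in> {k + 1, k + 2, k + 3, k + 4}"


section \<open>Existence of the Clifford algebras\<close>

text \<open>One algebra that contains generators for every signature: real combinations of finite sets of
  natural numbers, where even numbers square to \<open>1\<close> and odd numbers square to \<open>- 1\<close>. Products of
  basis elements are given by the symmetric difference of the index sets and the sign
  \<open>cl_sign\<close>.\<close>

definition sdiff :: "'b set \<Rightarrow> 'b set \<Rightarrow> 'b set" where
  "sdiff A B = (A - B) \<union> (B - A)"

definition cl_swap :: "nat \<Rightarrow> nat \<Rightarrow> real" where
  "cl_swap a b = (if a > b \<or> (a = b \<and> odd a) then - 1 else 1)"

definition cl_sign :: "nat set \<Rightarrow> nat set \<Rightarrow> real" where
  "cl_sign A B = (\<Prod>a\<in>A. \<Prod>b\<in>B. cl_swap a b)"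

lemma sdiff_simps [simp]:
  "sdiff A (sdiff A B) = B" "sdiff {} A = A" "sdiff A {} = A" "sdiff A A = {}"
  by (auto simp: sdiff_def)

lemma sdiff_assoc: "sdiff (sdiff A B) C = sdiff A (sdiff B C)"
  by (auto simp: sdiff_def)

lemma sdiff_commute: "sdiff A B = sdiff B A"
  by (auto simp: sdiff_def)

lemma sdiff_eq_iff: "sdiff A B = C \<longleftrightarrow> B = sdiff A C"
  by (auto simp: sdiff_def)

lemma finite_sdiff [simp]: "finite A \<Longrightarrow> finite B \<Longrightarrow> finite (sdiff A B)"
  by (auto simp: sdiff_def)

lemma prod_sdiff:
  fixes h :: "'b \<Rightarrow> real"
  assumes "finite A" "finite B" "\<And>x. h x * h x = 1"
  shows "prod h (sdiff A B) = prod h A * prod h B"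
proof -
  have A: "prod h A = prod h (A - B) * prod h (A \<inter> B)"
    using prod.Int_Diff [OF assms(1), of h B] by (simp add: mult.commute)
  have B: "prod h B = prod h (B - A) * prod h (A \<inter> B)"
    using prod.Int_Diff [OF assms(2), of h A] by (simp add: mult.commute Int_commute)
  have "prod h (A \<inter> B) * prod h (A \<inter> B) = 1"
    by (simp add: prod.distrib [symmetric] assms(3))
  moreover have "prod h (sdiff A B) = prod h (A - B) * prod h (B - A)"
    unfolding sdiff_def using assms by (intro prod.union_disjoint) auto
  ultimately show ?thesis unfolding A B by algebra
qed

lemma cl_swap_square: "cl_swap a b * cl_swap a b = 1"
  by (simp add: cl_swap_def)

lemma cl_sign_sdiff_left:
  "finite A \<Longrightarrow> finite B \<Longrightarrow> cl_sign (sdiff A B) C = cl_sign A C * cl_sign B C"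
  unfolding cl_sign_def by (rule prod_sdiff) (auto simp: prod.distrib [symmetric] cl_swap_square)

lemma cl_sign_sdiff_right:
  "finite B \<Longrightarrow> finite C \<Longrightarrow> cl_sign A (sdiff B C) = cl_sign A B * cl_sign A C"
  unfolding cl_sign_def by (simp add: prod_sdiff cl_swap_square prod.distrib)

lemma cl_sign_empty [simp]: "cl_sign {} A = 1" "cl_sign A {} = 1"
  by (auto simp: cl_sign_def)

definition cl_supp :: "(nat set \<Rightarrow> real) \<Rightarrow> nat set set" where
  "cl_supp f = {A. f A \<noteq> 0}"

definition cl_mult :: "(nat set \<Rightarrow> real) \<Rightarrow> (nat set \<Rightarrow> real) \<Rightarrow> nat set \<Rightarrow> real" where
  "cl_mult f h S = (\<Sum>A\<in>cl_supp f. cl_sign A (sdiff A S) * f A * h (sdiff A S))"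

typedef cl_model = "{f. finite (cl_supp f) \<and> cl_supp f \<subseteq> Collect finite}"
  by (rule exI [of _ "\<lambda>_. 0"]) (auto simp: cl_supp_def)

lemma Rep_supp: "finite (cl_supp (Rep_cl_model x))" "A \<in> cl_supp (Rep_cl_model x) \<Longrightarrow> finite A"
  using Rep_cl_model [of x] by auto

lemma Rep_Abs_cl_model:
  assumes "cl_supp f \<subseteq> cl_supp (Rep_cl_model x) \<union> cl_supp (Rep_cl_model y)"
  shows "Rep_cl_model (Abs_cl_model f) = f"
proof (rule Abs_cl_model_inverse)
  have "finite (cl_supp f)"
    by (rule finite_subset [OF assms]) (simp add: Rep_supp)
  then show "f \<in> {f. finite (cl_supp f) \<and> cl_supp f \<subseteq> Collect finite}"
    using assms Rep_supp(2) by blast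
qed

lemma cl_mult_superset:
  assumes "finite F" "cl_supp f \<subseteq> F"
  shows "cl_mult f h S = (\<Sum>A\<in>F. cl_sign A (sdiff A S) * f A * h (sdiff A S))"
  unfolding cl_mult_def by (rule sum.mono_neutral_left) (use assms in \<open>auto simp: cl_supp_def\<close>)

lemma supp_cl_mult: "cl_supp (cl_mult f h) \<subseteq> (\<lambda>(A, B). sdiff A B) ` (cl_supp f \<times> cl_supp h)"
proof
  fix S assume "S \<in> cl_supp (cl_mult f h)"
  then have "(\<Sum>A\<in>cl_supp f. cl_sign A (sdiff A S) * f A * h (sdiff A S)) \<noteq> 0"
    by (simp add: cl_supp_def cl_mult_def)
  then obtain A where "A \<in> cl_supp f" "cl_sign A (sdiff A S) * f A * h (sdiff A S) \<noteq> 0"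
    by (rule sum.not_neutral_contains_not_neutral)
  then show "S \<in> (\<lambda>(A, B). sdiff A B) ` (cl_supp f \<times> cl_supp h)"
    by (intro image_eqI [of _ _ "(A, sdiff A S)"]) (auto simp: cl_supp_def)
qed

instantiation cl_model :: real_algebra_1
begin

definition "0 = Abs_cl_model (\<lambda>_. 0)"
definition "1 = Abs_cl_model (\<lambda>A. if A = {} then 1 else 0)"
definition "x + y = Abs_cl_model (\<lambda>A. Rep_cl_model x A + Rep_cl_model y A)"
definition "x - y = Abs_cl_model (\<lambda>A. Rep_cl_model x A - Rep_cl_model y A)"
definition "- x = Abs_cl_model (\<lambda>A. - Rep_cl_model x A)"
definition "c *\<^sub>R x = Abs_cl_model (\<lambda>A. c * Rep_cl_model x A)"
definition "x * y = Abs_cl_model (cl_mult (Rep_cl_model x) (Rep_cl_model y))"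

lemma Rep_zero: "Rep_cl_model 0 = (\<lambda>_. 0)"
  unfolding zero_cl_model_def by (rule Abs_cl_model_inverse) (auto simp: cl_supp_def)

lemma Rep_one: "Rep_cl_model 1 = (\<lambda>A. if A = {} then 1 else 0)"
  unfolding one_cl_model_def by (rule Abs_cl_model_inverse) (auto simp: cl_supp_def)

lemma Rep_plus: "Rep_cl_model (x + y) = (\<lambda>A. Rep_cl_model x A + Rep_cl_model y A)"
  unfolding plus_cl_model_def by (rule Rep_Abs_cl_model [of _ x y]) (auto simp: cl_supp_def)

lemma Rep_minus: "Rep_cl_model (x - y) = (\<lambda>A. Rep_cl_model x A - Rep_cl_model y A)"
  unfolding minus_cl_model_def by (rule Rep_Abs_cl_model [of _ x y]) (auto simp: cl_supp_def)

lemma Rep_uminus: "Rep_cl_model (- x) = (\<lambda>A. - Rep_cl_model x A)"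
  unfolding uminus_cl_model_def by (rule Rep_Abs_cl_model [of _ x x]) (auto simp: cl_supp_def)

lemma Rep_scaleR: "Rep_cl_model (c *\<^sub>R x) = (\<lambda>A. c * Rep_cl_model x A)"
  unfolding scaleR_cl_model_def by (rule Rep_Abs_cl_model [of _ x x]) (auto simp: cl_supp_def)

lemma Rep_times: "Rep_cl_model (x * y) = cl_mult (Rep_cl_model x) (Rep_cl_model y)"
proof -
  note s = supp_cl_mult [of "Rep_cl_model x" "Rep_cl_model y"]
  have "finite (cl_supp (cl_mult (Rep_cl_model x) (Rep_cl_model y)))"
    by (rule finite_subset [OF s]) (simp add: Rep_supp)
  moreover have "finite A" if "A \<in> cl_supp (cl_mult (Rep_cl_model x) (Rep_cl_model y))" for A
    using subsetD [OF s that] by (auto dest!: Rep_supp(2))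
  ultimately show ?thesis
    unfolding times_cl_model_def by (intro Abs_cl_model_inverse) auto
qed

lemmas Rep_ops = Rep_zero Rep_one Rep_plus Rep_minus Rep_uminus Rep_scaleR Rep_times

lemma cl_model_assoc: "(x * y) * z = x * (y * z)" for x y z :: cl_model
proof (rule Rep_cl_model_inject [THEN iffD1], rule ext)
  fix S
  define f h k where "f = Rep_cl_model x" and "h = Rep_cl_model y" and "k = Rep_cl_model z"
  define F G where "F = cl_supp f" and "G = cl_supp h"
  have fin: "finite F" "finite G" and fin': "\<And>A. A \<in> F \<Longrightarrow> finite A" "\<And>A. A \<in> G \<Longrightarrow> finite A"
    unfolding F_def G_def f_def h_def by (auto intro: Rep_supp)
  define P where "P = (\<lambda>(A, B). sdiff A B) ` (F \<times> G)"
  have finP: "finite P" unfolding P_def using fin by auto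
  have L: "cl_mult f h A = (\<Sum>B\<in>F. cl_sign B (sdiff B A) * f B * h (sdiff B A))" for A
    unfolding F_def cl_mult_def ..
  have "Rep_cl_model ((x * y) * z) S = cl_mult (cl_mult f h) k S"
    by (simp add: Rep_times f_def h_def k_def)
  also have "\<dots> = (\<Sum>A\<in>P. cl_sign A (sdiff A S) * cl_mult f h A * k (sdiff A S))"
    by (rule cl_mult_superset) (use finP supp_cl_mult in \<open>auto simp: P_def F_def G_def\<close>)
  also have "\<dots> = (\<Sum>A\<in>P. \<Sum>B\<in>F. cl_sign A (sdiff A S) * cl_sign B (sdiff B A) * f B * h (sdiff B A) * k (sdiff A S))"
    unfolding L by (simp add: sum_distrib_left sum_distrib_right mult_ac)
  also have "\<dots> = (\<Sum>B\<in>F. \<Sum>A\<in>P. cl_sign A (sdiff A S) * cl_sign B (sdiff B A) * f B * h (sdiff B A) * k (sdiff A S))"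
    by (rule sum.swap)
  also have "\<dots> = (\<Sum>B\<in>F. \<Sum>C\<in>G. cl_sign (sdiff B C) (sdiff (sdiff B C) S) * cl_sign B C * f B * h C * k (sdiff (sdiff B C) S))"
  proof (rule sum.cong [OF refl])
    fix B assume B: "B \<in> F"
    let ?t = "\<lambda>A. cl_sign A (sdiff A S) * cl_sign B (sdiff B A) * f B * h (sdiff B A) * k (sdiff A S)"
    have "(\<Sum>A\<in>P. ?t A) = (\<Sum>A\<in>sdiff B ` G. ?t A)"
    proof (rule sum.mono_neutral_right [OF finP])
      show "sdiff B ` G \<subseteq> P" using B by (auto simp: P_def)
      show "\<forall>A\<in>P - sdiff B ` G. ?t A = 0"
      proof
        fix A assume "A \<in> P - sdiff B ` G"
        then have "sdiff B A \<notin> G" by (metis DiffD2 image_eqI sdiff_simps(1))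
        then show "?t A = 0" by (simp add: G_def cl_supp_def)
      qed
    qed
    also have "\<dots> = (\<Sum>C\<in>G. ?t (sdiff B C))"
      by (subst sum.reindex) (auto intro: inj_on_inverseI [of _ "sdiff B"])
    finally show "(\<Sum>A\<in>P. ?t A) = (\<Sum>C\<in>G. cl_sign (sdiff B C) (sdiff (sdiff B C) S) * cl_sign B C * f B * h C * k (sdiff (sdiff B C) S))"
      by simp
  qed
  also have "\<dots> = (\<Sum>B\<in>F. \<Sum>C\<in>G. cl_sign B (sdiff B S) * f B * (cl_sign C (sdiff C (sdiff B S)) * h C * k (sdiff C (sdiff B S))))"
  proof (intro sum.cong refl)
    fix B C assume BC: "B \<in> F" "C \<in> G"
    have e: "sdiff (sdiff B C) S = sdiff C (sdiff B S)"
      by (metis sdiff_assoc sdiff_commute)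
    show "cl_sign (sdiff B C) (sdiff (sdiff B C) S) * cl_sign B C * f B * h C * k (sdiff (sdiff B C) S) =
      cl_sign B (sdiff B S) * f B * (cl_sign C (sdiff C (sdiff B S)) * h C * k (sdiff C (sdiff B S)))"
    proof (cases "k (sdiff C (sdiff B S)) = 0")
      case True then show ?thesis by (simp add: e)
    next
      case False
      define D where "D = sdiff C (sdiff B S)"
      from False have "finite D" unfolding D_def k_def by (intro Rep_supp(2)) (auto simp: cl_supp_def)
      moreover have "sdiff B S = sdiff C D" by (simp add: D_def)
      ultimately have "cl_sign B (sdiff B S) = cl_sign B C * cl_sign B D"
        using fin' BC by (simp add: cl_sign_sdiff_right)
      moreover have "cl_sign (sdiff B C) D = cl_sign B D * cl_sign C D"
        using fin' BC by (simp add: cl_sign_sdiff_left)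
      ultimately show ?thesis unfolding e D_def [symmetric] by simp
    qed
  qed
  also have "\<dots> = (\<Sum>B\<in>F. cl_sign B (sdiff B S) * f B * cl_mult h k (sdiff B S))"
    unfolding cl_mult_def G_def by (simp add: sum_distrib_left)
  also have "\<dots> = Rep_cl_model (x * (y * z)) S"
    by (simp add: Rep_times f_def h_def k_def F_def cl_mult_def)
  finally show "Rep_cl_model (x * y * z) S = Rep_cl_model (x * (y * z)) S" .
qed

lemma cl_model_distrib_right: "(x + y) * z = x * z + y * z" for x y z :: cl_model
proof -
  let ?F = "cl_supp (Rep_cl_model x) \<union> cl_supp (Rep_cl_model y)"
  have F: "finite ?F" by (simp add: Rep_supp)
  show ?thesis
    apply (subst Rep_cl_model_inject [symmetric])
    apply (rule ext)
    apply (simp add: Rep_times Rep_plus)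
    apply (subst (1 2 3) cl_mult_superset [OF F])
       apply (auto simp: cl_supp_def sum.distrib [symmetric] algebra_simps)
    done
qed

lemma cl_model_scaleR_left: "(c *\<^sub>R x) * y = c *\<^sub>R (x * y)" for x y :: cl_model
proof -
  let ?F = "cl_supp (Rep_cl_model x)"
  have F: "finite ?F" by (simp add: Rep_supp)
  show ?thesis
    apply (subst Rep_cl_model_inject [symmetric])
    apply (rule ext)
    apply (simp add: Rep_times Rep_scaleR)
    apply (subst (1 2) cl_mult_superset [OF F])
       apply (auto simp: cl_supp_def sum_distrib_left mult_ac)
    done
qed

instance
proof
  fix a b c :: cl_model and r s :: real
  note inj = Rep_cl_model_inject [symmetric] and fe = fun_eq_iff
  show "a + b + c = a + (b + c)" "a + b = b + a" "0 + a = a" "- a + a = 0" "a - b = a + - b"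
    by (simp_all add: inj Rep_ops fe)
  show "r *\<^sub>R (a + b) = r *\<^sub>R a + r *\<^sub>R b" "(r + s) *\<^sub>R a = r *\<^sub>R a + s *\<^sub>R a"
    "r *\<^sub>R s *\<^sub>R a = (r * s) *\<^sub>R a" "1 *\<^sub>R a = a"
    by (simp_all add: inj Rep_ops fe algebra_simps)
  show "a * b * c = a * (b * c)" by (rule cl_model_assoc)
  show "(a + b) * c = a * c + b * c" by (rule cl_model_distrib_right)
  show "a * (b + c) = a * b + a * c"
    by (simp add: inj Rep_ops fe cl_mult_def sum.distrib [symmetric] algebra_simps)
  show "r *\<^sub>R a * b = r *\<^sub>R (a * b)" by (rule cl_model_scaleR_left)
  show "a * r *\<^sub>R b = r *\<^sub>R (a * b)"
    by (simp add: inj Rep_ops fe cl_mult_def sum_distrib_left mult_ac)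
  show "1 * a = a"
    by (simp add: inj Rep_ops fe cl_mult_superset [of "{{}}"] cl_supp_def)
  show "a * 1 = a"
  proof (unfold inj, rule ext)
    fix S
    let ?f = "Rep_cl_model a"
    have "Rep_cl_model (a * 1) S = (\<Sum>A\<in>cl_supp ?f. if A = S then ?f S else 0)"
      unfolding Rep_ops cl_mult_def by (rule sum.cong) (auto simp: sdiff_eq_iff sdiff_def)
    then show "Rep_cl_model (a * 1) S = ?f S"
      by (simp add: Rep_supp) (simp add: cl_supp_def)
  qed
  show "(0 :: cl_model) \<noteq> 1" by (auto simp: inj Rep_ops fe)
qed

end

definition cl_unit :: "nat set \<Rightarrow> cl_model" where
  "cl_unit A = Abs_cl_model (\<lambda>B. if B = A then 1 else 0)"

lemma Rep_cl_unit: "finite A \<Longrightarrow> Rep_cl_model (cl_unit A) = (\<lambda>B. if B = A then 1 else 0)"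
  unfolding cl_unit_def by (rule Abs_cl_model_inverse) (auto simp: cl_supp_def)

lemma cl_unit_mult:
  assumes "finite A" "finite B"
  shows "cl_unit A * cl_unit B = cl_sign A B *\<^sub>R cl_unit (sdiff A B)"
proof -
  have "cl_mult (Rep_cl_model (cl_unit A)) h S = cl_sign A (sdiff A S) * h (sdiff A S)" for h S
    using assms by (subst cl_mult_superset [of "{A}"]) (auto simp: cl_supp_def Rep_cl_unit)
  then show ?thesis using assms
    by (auto simp: Rep_cl_model_inject [symmetric] Rep_times Rep_scaleR Rep_cl_unit fun_eq_iff sdiff_eq_iff)
qed

lemma cl_unit_empty: "cl_unit {} = 1"
  by (simp add: Rep_cl_model_inject [symmetric] Rep_cl_unit Rep_one)

lemma independent_cl_unit:
  assumes "\<And>A. A \<in> I \<Longrightarrow> finite A"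
  shows "independent (cl_unit ` I)" "inj_on cl_unit I"
proof -
  show inj: "inj_on cl_unit I"
  proof (rule inj_onI)
    fix A B assume AB: "A \<in> I" "B \<in> I" "cl_unit A = cl_unit B"
    have "(\<lambda>S. if S = A then 1 else 0 :: real) = (\<lambda>S. if S = B then 1 else 0)"
      using arg_cong [OF AB(3), of Rep_cl_model] AB(1,2) assms by (simp add: Rep_cl_unit)
    from fun_cong [OF this, of A] show "A = B" by (simp split: if_splits)
  qed
  show "independent (cl_unit ` I)"
    unfolding real_vector.independent_explicit_finite_subsets
  proof clarify
    fix T u v
    assume T: "T \<subseteq> cl_unit ` I" "finite T" and 0: "(\<Sum>v\<in>T. u v *\<^sub>R v) = 0" and v: "v \<in> T"
    then obtain A where A: "A \<in> I" "v = cl_unit A" by auto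
    have Rep_sum: "Rep_cl_model (sum f T) A = (\<Sum>x\<in>T. Rep_cl_model (f x) A)" for f
      using T(2) by induction (auto simp: Rep_zero Rep_plus)
    have "0 = (\<Sum>x\<in>T. u x * Rep_cl_model x A)"
      using arg_cong [OF 0, of "\<lambda>x. Rep_cl_model x A"] by (simp add: Rep_sum Rep_scaleR Rep_zero)
    also have "\<dots> = (\<Sum>x\<in>T. if x = v then u x else 0)"
    proof (rule sum.cong [OF refl])
      fix x assume "x \<in> T"
      with T obtain B where B: "B \<in> I" "x = cl_unit B" by auto
      then show "u x * Rep_cl_model x A = (if x = v then u x else 0)"
        using A assms inj by (auto simp: Rep_cl_unit inj_on_def)
    qed
    also have "\<dots> = u v" using T v by simp
    finally show "u v = 0" by simp
  qed
qed

theorem clifford_generators_exist: "\<exists>g :: nat \<Rightarrow> cl_model. clifford_generators p q g"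
proof -
  define f :: "nat \<Rightarrow> nat" where "f a = (if a \<le> p then 2 * a else 2 * a + 1)" for a
  define g where "g a = cl_unit {f a}" for a
  have f_less: "a < b \<Longrightarrow> f a < f b" for a b by (auto simp: f_def)
  have f_inj: "inj f" by (rule linorder_injI) (metis f_less less_irrefl)
  have prod: "prod_list (map g xs) = cl_unit (f ` set xs)" if "sorted_wrt (<) xs" for xs
    using that
  proof (induction xs)
    case Nil
    then show ?case by (simp add: cl_unit_empty)
  next
    case (Cons x xs)
    have "cl_sign {f x} (f ` set xs) = 1"
    proof -
      have "cl_swap (f x) (f y) = 1" if "y \<in> set xs" for y
        using Cons.prems that f_less [of x y] by (auto simp: cl_swap_def)
      then show ?thesis
        unfolding cl_sign_def by (auto intro!: prod.neutral)
    qed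
    moreover have "sdiff {f x} (f ` set xs) = insert (f x) (f ` set xs)"
      using Cons.prems inj_eq [OF f_inj] by (auto simp: sdiff_def)
    ultimately show ?case using Cons by (simp add: g_def cl_unit_mult)
  qed
  have be: "basis_elt g A = cl_unit (f ` A)" if "finite A" for A
    unfolding basis_elt_def using prod [of "sorted_list_of_set A"] that by simp
  have img: "basis_elt g ` Pow {1..p+q} = cl_unit ` (`) f ` Pow {1..p+q}"
    by (subst image_image, rule image_cong [OF refl]) (rule be, auto intro: finite_subset)
  have fin: "finite A" if "A \<in> (`) f ` Pow {1..p+q}" for A
    using that by (auto intro: finite_subset)
  have "inj_on (cl_unit \<circ> (`) f) (Pow {1..p+q})"
    by (intro comp_inj_on independent_cl_unit(2) fin) (auto simp: inj_on_def inj_image_eq_iff [OF f_inj])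
  then have "inj_on (basis_elt g) (Pow {1..p+q})"
    by (subst inj_on_cong [of _ _ "cl_unit \<circ> (`) f"]) (auto intro!: be intro: finite_subset)
  moreover have "independent (basis_elt g ` Pow {1..p+q})"
    unfolding img by (rule independent_cl_unit(1)) (rule fin)
  moreover have "g a * g b + g b * g a = (2 * clifford_metric p a b) *\<^sub>R 1" for a b
  proof (cases "a = b")
    case True
    then show ?thesis
      by (auto simp: g_def cl_unit_mult cl_unit_empty cl_sign_def cl_swap_def clifford_metric_def f_def
          scaleR_2 [symmetric])
  next
    case False
    then have "f a < f b \<or> f b < f a" using inj_eq [OF f_inj] by (metis linorder_neq_iff)
    then show ?thesis using False
      by (auto simp: g_def cl_unit_mult cl_sign_def cl_swap_def clifford_metric_def sdiff_commute [of "{f b}"])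
  qed
  ultimately show ?thesis unfolding clifford_generators_def by blast
qed

end

theory Submission
  imports Defs
begin

text \<open>For basis elements with index sets \<open>A\<close>, \<open>B\<close> the products in the two orders agree up to the sign
  \<open>(-1)\<close> to the power \<open>|A| |B| + |A \<inter> B|\<close>, and both are multiples of the basis element of the
  symmetric difference. Hence the commutator vanishes unless \<open>|A| |B| + |A \<inter> B|\<close> is odd, and
  otherwise it has rank \<open>|A| + |B| - 2 |A \<inter> B|\<close>, where \<open>|A| + |B| - |A \<inter> B| \<le> n\<close>. Whether the sum of
  the spaces with ranks in \<open>K\<close> is a Lie algebra thus becomes a question of linear arithmetic and
  parities on \<open>K\<close>. Adding rank \<open>0\<close> or (with the stated parity restrictions) rank \<open>n\<close> does no harm,
  because those elements commute with everything that is present.\<close>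

section \<open>Arithmetic of ranks\<close>

text \<open>Modulo 4, subtracting \<open>2 * i\<close> is the same as adding it, and
  \<open>2 * i\<close> modulo 4 sees only the parity of \<open>i\<close>.\<close>

lemma mod_4_cancel_double:
  fixes a b c i :: nat
  assumes "c + 2 * i = a + b"
  shows "c mod 4 = (a mod 4 + b mod 4 + 2 * (i mod 2)) mod 4"
proof -
  have "c mod 4 = (c + i * 4) mod 4" by simp
  also have "c + i * 4 = a + b + 2 * i" using assms by simp
  also have "\<dots> mod 4 = ((a mod 4 + b mod 4) mod 4 + (2 * i) mod 4) mod 4" by (simp only: mod_add_eq)
  also have "\<dots> = (a mod 4 + b mod 4 + (2 * i) mod 4) mod 4" by (rule mod_add_left_eq)
  also have "(2 * i) mod 4 = 2 * (i mod 2)" using mult_mod_right [of 2 i 2] by simp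
  finally show ?thesis .
qed

lemma even_iff_mod_4: "even (a :: nat) \<longleftrightarrow> a mod 4 = 0 \<or> a mod 4 = 2"
  by presburger

text \<open>The parity condition determines \<open>i\<close> modulo 2 from the parities of
  \<open>a\<close> and \<open>b\<close>, so the residue of \<open>c\<close> is a function of the
  residues of \<open>a\<close> and \<open>b\<close>. What remains is a finite table for each choice
  of \<open>P\<close>.\<close>

lemma residues_closed:
  fixes a b c i :: nat
  assumes "c + 2 * i = a + b" "odd a \<and> odd b \<longleftrightarrow> even i" "P = {2, 3} \<or> P = {1, 2} \<or> P = {2}"
    "a mod 4 \<in> P" "b mod 4 \<in> P"
  shows "c mod 4 \<in> P"
proof -
  have "i mod 2 = (if odd a \<and> odd b then 0 else 1)"
    using assms(2) by (simp add: mod2_eq_if)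
  then show ?thesis
    using assms(3-5) unfolding mod_4_cancel_double [OF assms(1)] even_iff_mod_4 by auto
qed

lemma nat_eq_mult_add_offset:
  fixes n a b :: nat
  assumes "a \<le> n" "0 < b"
  obtains m d where "n = b * m + a + d" "d < b"
proof
  show "n = b * ((n - a) div b) + a + (n - a) mod b"
    using assms(1) mult_div_mod_eq [of b "n - a"] by linarith
  show "(n - a) mod b < b" using assms(2) by simp
qed

lemma mod_4_offset: "(4 * m + 2) mod 4 = (2::nat)" "(4 * m + 3) mod 4 = (3::nat)"
  using mod_mult_self4 [of 4 m 2] mod_mult_self4 [of 4 m 3] by simp_all

text \<open>The first entry is split off because simplification unfolds an interval list only between
  numerals of the form \<open>numeral w\<close>, and \<open>1\<close> is not of that form.\<close>

lemma ranks_eq_set_filter: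
  assumes "k \<ge> 1"
  shows "{j. 1 \<le> j \<and> j \<le> k \<and> P j} = set (filter P (1 # [2..<Suc k]))"
proof -
  have "set (1 # [2..<Suc k]) = {1..k}" using assms by auto
  then show ?thesis unfolding set_filter by auto
qed

section \<open>The last rank: maximality, existence and uniqueness\<close>

lemma last_rank_le:
  "last_rank_23 n k \<Longrightarrow> k \<le> n" "last_rank_02 n k \<Longrightarrow> k < n"
  "last_rank_12 n k \<Longrightarrow> k \<le> n" "last_rank_2 n k \<Longrightarrow> k < n"
  unfolding last_rank_23_def last_rank_02_def last_rank_12_def last_rank_2_def by auto

text \<open>The window for \<open>n\<close> leaves at most two values of \<open>j\<close> above
  \<open>k\<close>; each has residue 0 or 1, or is \<open>n\<close> itself with \<open>n\<close>
  odd. The premise on \<open>j = n\<close> matches commutators, whose rank can be \<open>n\<close>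
  only for even \<open>n\<close>.\<close>

lemma last_rank_23_max:
  assumes k: "last_rank_23 n k" and j: "j mod 4 \<in> {2, 3}" "j \<le> n" "j = n \<Longrightarrow> even n"
  shows "j \<le> k"
proof (rule ccontr)
  assume "\<not> j \<le> k"
  moreover obtain m where "k = 4 * m + 2 \<or> k = 4 * m + 3"
    using k mult_div_mod_eq [of 4 k] unfolding last_rank_23_def by (metis insertE singletonD)
  ultimately have "k = 4 * m + 2 \<and> n = 4 * m + 3 \<and> j = n \<or> k = 4 * m + 3 \<and> j = 4 * m + 4 \<or>
      k = 4 * m + 3 \<and> j = 4 * m + 5"
    using k j(2) unfolding last_rank_23_def by auto
  then show False using j(1,3) by auto
qed

lemma last_rank_02_max:
  assumes "last_rank_02 n k" "even j" "j \<le> n" "j \<noteq> n"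
  shows "j \<le> k"
proof (rule ccontr)
  assume "\<not> j \<le> k"
  then have "j = k + 1" using assms unfolding last_rank_02_def by auto
  then show False using assms unfolding last_rank_02_def by simp
qed

text \<open>After \<open>k = 4 * m + 2\<close> the next rank of residue 1 or 2 is
  \<open>4 * m + 5\<close>, the upper end of the window for \<open>n\<close>. It could only be
  \<open>n\<close> itself, which is then odd.\<close>

lemma last_rank_12_max:
  assumes k: "last_rank_12 n k" and j: "j mod 4 \<in> {1, 2}" "j \<le> n" "j = n \<Longrightarrow> even n"
  shows "j \<le> k"
proof (rule ccontr)
  assume "\<not> j \<le> k"
  moreover obtain m where "k = 4 * m + 2"
    using k mult_div_mod_eq [of 4 k] unfolding last_rank_12_def by metis
  ultimately have "j = 4 * m + 3 \<or> j = 4 * m + 4 \<or> j = n \<and> n = 4 * m + 5"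
    using k j(2) unfolding last_rank_12_def by auto
  then show False using j(1,3) by auto
qed

lemma last_rank_2_max:
  assumes k: "last_rank_2 n k" and j: "j mod 4 = 2" "j \<le> n" "j \<noteq> n"
  shows "j \<le> k"
proof (rule ccontr)
  assume "\<not> j \<le> k"
  moreover obtain m where "k = 4 * m + 2"
    using k mult_div_mod_eq [of 4 k] unfolding last_rank_2_def by metis
  ultimately have "j = 4 * m + 3 \<or> j = 4 * m + 4 \<or> j = 4 * m + 5"
    using k j(2,3) unfolding last_rank_2_def by auto
  then show False using j(1) by auto
qed

lemma ex1_last_rank_23: assumes "n \<ge> 2" shows "\<exists>!k. last_rank_23 n k"
proof (rule ex_ex1I)
  obtain m d where n: "n = 4 * m + 2 + d" "d < 4"
    using assms nat_eq_mult_add_offset [of 2 n 4] by auto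
  \<comment> \<open>For \<open>d < 2\<close> the number \<open>n\<close> has residue 2 or 3, and an
    odd \<open>n\<close> is left out; for larger \<open>d\<close> the rank \<open>4 * m + 3\<close>
    lies below \<open>n\<close>.\<close>
  then have "last_rank_23 n (if d < 2 then 4 * m + 2 else 4 * m + 3)"
    unfolding last_rank_23_def using mod_4_offset [of m] by auto
  then show "\<exists>k. last_rank_23 n k" by blast
  \<comment> \<open>Uniqueness: each last rank is maximal, so any two of them bound each
    other.\<close>
  have "l \<le> k" if "last_rank_23 n k" "last_rank_23 n l" for k l
    using that last_rank_le(1) [of n l]
    by (intro last_rank_23_max [OF that(1)]) (auto simp: last_rank_23_def)
  then show "k = l" if "last_rank_23 n k" "last_rank_23 n l" for k l
    using that by (meson le_antisym)
qed

lemma ex1_last_rank_02: assumes "n \<ge> 3" shows "\<exists>!k. last_rank_02 n k"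
proof (rule ex_ex1I)
  obtain m d where n: "n = 2 * m + 3 + d" "d < 2"
    using assms nat_eq_mult_add_offset [of 3 n 2] by auto
  then have "last_rank_02 n (2 * m + 2)"
    unfolding last_rank_02_def by auto
  then show "\<exists>k. last_rank_02 n k" by blast
  show "k = l" if "last_rank_02 n k" "last_rank_02 n l" for k l
    using that last_rank_02_max [of n k l] last_rank_02_max [of n l k] last_rank_le(2) [of n]
    by (auto simp: last_rank_02_def)
qed

lemma ex1_last_rank_12: assumes "n \<ge> 2" shows "\<exists>!k. last_rank_12 n k"
proof (rule ex_ex1I)
  obtain m d where n: "n = 4 * m + 2 + d" "d < 4"
    using assms nat_eq_mult_add_offset [of 2 n 4] by auto
  then have "last_rank_12 n (4 * m + 2)"
    unfolding last_rank_12_def using mod_4_offset [of m] by auto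
  then show "\<exists>k. last_rank_12 n k" by blast
  have "l \<le> k" if "last_rank_12 n k" "last_rank_12 n l" for k l
    using that last_rank_le(3) [of n l]
    by (intro last_rank_12_max [OF that(1)]) (auto simp: last_rank_12_def even_iff_mod_4)
  then show "k = l" if "last_rank_12 n k" "last_rank_12 n l" for k l
    using that by (meson le_antisym)
qed

lemma ex1_last_rank_2: assumes "n \<ge> 3" shows "\<exists>!k. last_rank_2 n k"
proof (rule ex_ex1I)
  obtain m d where n: "n = 4 * m + 3 + d" "d < 4"
    using assms nat_eq_mult_add_offset [of 3 n 4] by auto
  then have "last_rank_2 n (4 * m + 2)"
    unfolding last_rank_2_def using mod_4_offset [of m] by auto
  then show "\<exists>k. last_rank_2 n k" by blast
  have "l \<le> k" if "last_rank_2 n k" "last_rank_2 n l" for k l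
    using that last_rank_le(4) [of n l]
    by (intro last_rank_2_max [OF that(1)]) (auto simp: last_rank_2_def)
  then show "k = l" if "last_rank_2 n k" "last_rank_2 n l" for k l
    using that by (meson le_antisym)
qed

text \<open>In the following lemmas \<open>a\<close> and \<open>b\<close> are the ranks of two non-commuting basis elements, \<open>i\<close> is the
  size of the intersection of their index sets, and \<open>c\<close> is the rank of the commutator.\<close>

lemma bracket_rank_1:
  fixes a c i :: nat
  assumes "i \<le> 1" "c + 2 * i = a + 1" "odd a \<longleftrightarrow> even i"
  shows "c = (if odd a then a + 1 else a - 1)"
proof -
  have "i = 0 \<or> i = 1" using assms(1) by linarith
  then show ?thesis using assms(2,3) by auto
qed

text \<open>Of the possible overlaps 0, 1, 2 only 1 is odd, so bracketing with rank 2 preserves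
  every rank: this is the infinitesimal orthogonal action.\<close>

lemma bracket_rank_2:
  fixes a c i :: nat
  assumes "i \<le> 2" "c + 2 * i = a + 2" "odd i"
  shows "c = a"
proof -
  have "i = 0 \<or> i = 1 \<or> i = 2" using assms(1) by linarith
  then show ?thesis using assms(2,3) by auto
qed

text \<open>The symmetric difference of two sets is also that of their complements, so ranks near
  \<open>n\<close> behave like the low ranks \<open>n - a\<close> and \<open>n - b\<close> with
  overlap \<open>e\<close>. In all cases listed \<open>c + 2 * e\<close> is at most 4, which leaves
  few values of \<open>e\<close>.\<close>

lemma bracket_large_ranks:
  fixes a b c i n :: nat
  assumes "c + i \<le> n" "c + 2 * i = a + b" "1 \<le> c" "odd a \<and> odd b \<longleftrightarrow> even i"
  shows "n = a + 1 \<Longrightarrow> n = b + 1 \<Longrightarrow> c = 2"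
    and "n = a + 2 \<Longrightarrow> n = b + 2 \<Longrightarrow> c = 2"
    and "n = a + 1 \<Longrightarrow> n = b + 2 \<Longrightarrow> odd n \<Longrightarrow> c = 1"
    and "n = a + 2 \<Longrightarrow> n = b + 1 \<Longrightarrow> odd n \<Longrightarrow> c = 1"
    and "n = a \<Longrightarrow> n = b + 1 \<Longrightarrow> c = 1"
    and "n = a + 1 \<Longrightarrow> n = b \<Longrightarrow> c = 1"
    and "\<not> (n = a \<and> n = b)"
proof -
  \<comment> \<open>the size of the intersection of the complements of the two index sets\<close>
  obtain e where e: "n = c + i + e"
    using assms(1) le_Suc_ex by blast
  have "even c \<longleftrightarrow> (even a \<longleftrightarrow> even b)"
    using arg_cong [OF assms(2), of even] by simp
  \<comment> \<open>This fixes the parity of \<open>e\<close>. It excludes \<open>e = 0\<close>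
    where arithmetic alone would allow \<open>c = 3\<close> or \<open>c = 4\<close>.\<close>
  then have parity: "even n \<longleftrightarrow> ((even i \<longleftrightarrow> even a) \<longleftrightarrow> (even b \<longleftrightarrow> even e))"
    unfolding e by auto
  have ce: "c + 2 * e + a + b = 2 * n"
    using assms(2) e by linarith
  have cases: "e = 0 \<or> e = 1 \<or> e \<ge> 2" by linarith
  show "c = 2" if "n = a + 1" "n = b + 1"
    using cases that ce assms(3) by linarith
  show "c = 1" if "n = a" "n = b + 1"
    using cases that ce assms(3) by linarith
  show "c = 1" if "n = a + 1" "n = b"
    using cases that ce assms(3) by linarith
  show "\<not> (n = a \<and> n = b)"
    using ce assms(3) by auto
  have c3: "c = 1" if "c + 2 * e = 3" "odd n" "even a \<or> even b" "odd a \<or> odd b"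
  proof -
    have "e \<noteq> 0" using that parity assms(4) by auto
    then show ?thesis using cases that(1) assms(3) by linarith
  qed
  show "c = 1" if "n = a + 1" "n = b + 2" "odd n"
    using that ce by (intro c3) auto
  show "c = 1" if "n = a + 2" "n = b + 1" "odd n"
    using that ce by (intro c3) auto
  show "c = 2" if "n = a + 2" "n = b + 2"
  proof -
    have "e \<noteq> 0" using that parity assms(4) by auto
    then show ?thesis using cases that ce assms(3) by linarith
  qed
qed

lemma bracket_low_ranks:
  fixes a b c i :: nat
  assumes i: "i \<le> a" "i \<le> b" "c + 2 * i = a + b" "odd a \<and> odd b \<longleftrightarrow> even i"
  shows "b = 2 \<Longrightarrow> c = a"
    and "a = 2 \<Longrightarrow> c = b"
    and "b = 1 \<Longrightarrow> c = (if odd a then a + 1 else a - 1)"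
    and "a = 1 \<Longrightarrow> c = (if odd b then b + 1 else b - 1)"
proof -
  show "c = a" if "b = 2"
    using bracket_rank_2 [of i c a] i that by simp
  show "c = b" if "a = 2"
    using bracket_rank_2 [of i c b] i that by simp
  show "c = (if odd a then a + 1 else a - 1)" if "b = 1"
    using i that by (intro bracket_rank_1 [of i]) simp_all
  show "c = (if odd b then b + 1 else b - 1)" if "a = 1"
    using i that by (intro bracket_rank_1 [of i]) simp_all
qed

section \<open>Products of basis elements\<close>

lemma card_sdiff:
  assumes "finite A" "finite B"
  shows "card (sdiff A B) = card A + card B - 2 * card (A \<inter> B)"
proof -
  have "card (sdiff A B) = card (A - B) + card (B - A)"
    unfolding sdiff_def by (rule card_Un_disjoint) (use assms in auto)
  moreover have "card A = card (A - B) + card (A \<inter> B)" "card B = card (B - A) + card (A \<inter> B)"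
    using card_Diff_subset_Int [of A B] card_Diff_subset_Int [of B A] assms
      card_mono [of A "A \<inter> B"] card_mono [of B "A \<inter> B"]
    by (auto simp: Int_commute)
  ultimately show ?thesis by simp
qed

lemma basis_elt_empty [simp]: "basis_elt g {} = 1"
  by (simp add: basis_elt_def)

text \<open>Removing the smallest index removes the first factor of the ordered product, which is
  the step made by \<open>finite_linorder_min_induct\<close>.\<close>

lemma basis_elt_insert_min:
  assumes "finite A" "\<And>a. a \<in> A \<Longrightarrow> x < a"
  shows "basis_elt g (insert x A) = g x * basis_elt g A"
proof -
  have "Min (insert x A) = x"
    by (rule Min_eqI) (use assms in \<open>auto simp: less_imp_le\<close>)
  moreover have "insert x A - {x} = A"
    using assms(2) by auto
  ultimately show ?thesis
    unfolding basis_elt_def using assms(1) sorted_list_of_set_nonempty [of "insert x A"] by simp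
qed

locale clifford =
  fixes p q n :: nat and g :: "nat \<Rightarrow> 'a::real_algebra_1"
  assumes n_def: "n = p + q" and gens: "clifford_generators p q g"
begin

lemma gen_square:
  assumes "x \<in> {1..n}" shows "\<exists>s. g x * g x = s *\<^sub>R 1"
proof -
  have "2 *\<^sub>R (g x * g x) = (2 * clifford_metric p x x) *\<^sub>R 1"
    using gens assms unfolding clifford_generators_def n_def scaleR_2 by blast
  then have "(1/2) *\<^sub>R (2 *\<^sub>R (g x * g x)) = (1/2) *\<^sub>R ((2 * clifford_metric p x x) *\<^sub>R 1)"
    by simp
  then show ?thesis by (simp only: scaleR_scaleR) auto
qed

lemma gen_anticommute:
  assumes "x \<in> {1..n}" "y \<in> {1..n}" "x \<noteq> y" shows "g x * g y = - (g y * g x)"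
proof -
  have "g x * g y + g y * g x = (2 * clifford_metric p x y) *\<^sub>R 1"
    using gens assms unfolding clifford_generators_def n_def by blast
  then show ?thesis
    using assms by (simp add: clifford_metric_def eq_neg_iff_add_eq_0)
qed

text \<open>A generator whose index is below all of \<open>A\<close> becomes the first factor, one
  that equals the first factor is squared away, and one with a larger index moves past the first
  factor at the cost of a sign. The scalar stays unspecified because membership in a span holds for
  any scalar.\<close>

lemma gen_mult_basis_elt:
  assumes "finite A" "A \<subseteq> {1..n}" "x \<in> {1..n}"
  shows "\<exists>s. g x * basis_elt g A = s *\<^sub>R basis_elt g (sdiff {x} A)"
  using assms
proof (induction A rule: finite_linorder_min_induct)
  case empty
  have "basis_elt g {x} = g x"
    using basis_elt_insert_min [of "{}" x g] by simp
  then show ?case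
    by (intro exI [of _ 1]) simp
next
  case (insert m A)
  have bm: "basis_elt g (insert m A) = g m * basis_elt g A"
    using insert by (intro basis_elt_insert_min) auto
  consider "x < m" | "x = m" | "m < x" by linarith
  then show ?case
  proof cases
    case 1
    have "basis_elt g (insert x (insert m A)) = g x * basis_elt g (insert m A)"
      using insert 1 by (intro basis_elt_insert_min) auto
    moreover have "sdiff {x} (insert m A) = insert x (insert m A)"
      using insert 1 by (auto simp: sdiff_def)
    ultimately show ?thesis by (intro exI [of _ 1]) simp
  next
    case 2
    obtain s where "g x * g x = s *\<^sub>R 1" using gen_square insert by blast
    moreover have "sdiff {x} (insert m A) = A"
      using insert 2 by (auto simp: sdiff_def)
    ultimately show ?thesis
      unfolding bm using 2 by (intro exI [of _ s]) (simp add: mult.assoc [symmetric])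
  next
    case 3
    obtain s where s: "g x * basis_elt g A = s *\<^sub>R basis_elt g (sdiff {x} A)"
      using insert by auto
    have "g x * basis_elt g (insert m A) = - (g m * (g x * basis_elt g A))"
      unfolding bm using gen_anticommute [of x m] insert 3 by (simp add: mult.assoc [symmetric])
    also have "\<dots> = (- s) *\<^sub>R (g m * basis_elt g (sdiff {x} A))"
      unfolding s by simp
    \<comment> \<open>\<open>m\<close> is below every index of \<open>sdiff {x} A\<close>, so it can
      be put back in front.\<close>
    also have "g m * basis_elt g (sdiff {x} A) = basis_elt g (insert m (sdiff {x} A))"
      using insert 3 by (intro basis_elt_insert_min [symmetric]) (auto simp: sdiff_def)
    also have "insert m (sdiff {x} A) = sdiff {x} (insert m A)"
      using insert 3 by (auto simp: sdiff_def)
    finally show ?thesis by blast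
  qed
qed

text \<open>The factors of \<open>A\<close> are multiplied on one at a time. Inserting a new
  smallest index is a symmetric difference with a singleton, so associativity of
  \<open>sdiff\<close> keeps track of the index set.\<close>

lemma basis_elt_mult:
  assumes "finite A" "A \<subseteq> {1..n}" "B \<subseteq> {1..n}"
  shows "\<exists>s. basis_elt g A * basis_elt g B = s *\<^sub>R basis_elt g (sdiff A B)"
  using assms
proof (induction A rule: finite_linorder_min_induct)
  case empty
  show ?case by (intro exI [of _ 1]) simp
next
  case (insert m A)
  obtain s where s: "basis_elt g A * basis_elt g B = s *\<^sub>R basis_elt g (sdiff A B)"
    using insert by auto
  have "sdiff A B \<subseteq> {1..n}" using insert.prems by (auto simp: sdiff_def)
  then obtain t where t: "g m * basis_elt g (sdiff A B) = t *\<^sub>R basis_elt g (sdiff {m} (sdiff A B))"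
    using gen_mult_basis_elt [of "sdiff A B" m] insert.prems finite_subset [of _ "{1..n}"] by auto
  have "insert m A = sdiff {m} A" using insert by (auto simp: sdiff_def)
  then have "sdiff {m} (sdiff A B) = sdiff (insert m A) B" by (simp add: sdiff_assoc)
  moreover have "basis_elt g (insert m A) = g m * basis_elt g A"
    using insert by (intro basis_elt_insert_min) auto
  ultimately have "basis_elt g (insert m A) * basis_elt g B = (s * t) *\<^sub>R basis_elt g (sdiff (insert m A) B)"
    using s t by (simp add: mult.assoc)
  then show ?case by blast
qed

text \<open>Each of the \<open>card A\<close> factors costs a sign except \<open>g x\<close> itself,
  if present; adding this correction instead of subtracting it does not change the parity.\<close>

lemma gen_basis_elt_commute:
  assumes "finite A" "A \<subseteq> {1..n}" "x \<in> {1..n}"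
  shows "g x * basis_elt g A = (-1) ^ (card A + card ({x} \<inter> A)) *\<^sub>R (basis_elt g A * g x)"
  using assms
proof (induction A rule: finite_linorder_min_induct)
  case empty
  show ?case by simp
next
  case (insert m A)
  have bm: "basis_elt g (insert m A) = g m * basis_elt g A"
    using insert by (intro basis_elt_insert_min) auto
  have IH: "g x * basis_elt g A = (-1) ^ (card A + card ({x} \<inter> A)) *\<^sub>R (basis_elt g A * g x)"
    using insert by simp
  have m: "m \<notin> A" using insert by auto
  show ?case
  proof (cases "x = m")
    case True
    then have "{x} \<inter> A = {}" "{x} \<inter> insert m A = {x}" using m by auto
    moreover have "g m * (g m * basis_elt g A) = (-1) ^ card A *\<^sub>R (g m * (basis_elt g A * g m))"
      using IH True \<open>{x} \<inter> A = {}\<close> by simp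
    ultimately show ?thesis
      unfolding True bm mult.assoc using m insert.hyps(1) by simp
  next
    case False
    then have "{x} \<inter> insert m A = {x} \<inter> A" by auto
    moreover have "g x * g m = - (g m * g x)"
      using gen_anticommute [of x m] insert.prems False by simp
    then have "g x * (g m * basis_elt g A) = - (g m * (g x * basis_elt g A))"
      by (simp add: mult.assoc [symmetric])
    ultimately show ?thesis
      using IH m insert.hyps(1) by (simp add: bm mult.assoc)
  qed
qed

text \<open>The exponent is the sum, over the indices of \<open>A\<close>, of the exponents for
  single generators.\<close>

lemma basis_elt_commute:
  assumes "finite A" "A \<subseteq> {1..n}" "B \<subseteq> {1..n}"
  shows "basis_elt g A * basis_elt g B =
    (-1) ^ (card A * card B + card (A \<inter> B)) *\<^sub>R (basis_elt g B * basis_elt g A)"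
  using assms
proof (induction A rule: finite_linorder_min_induct)
  case empty
  show ?case by simp
next
  case (insert m A)
  have bm: "basis_elt g (insert m A) = g m * basis_elt g A"
    using insert by (intro basis_elt_insert_min) auto
  have IH: "basis_elt g A * basis_elt g B =
    (-1) ^ (card A * card B + card (A \<inter> B)) *\<^sub>R (basis_elt g B * basis_elt g A)"
    using insert by simp
  have B: "finite B" using insert finite_subset by auto
  have m: "m \<notin> A" using insert by auto
  have c: "card (insert m A \<inter> B) = card ({m} \<inter> B) + card (A \<inter> B)"
    using m insert.hyps(1) by (subst card_Un_disjoint [symmetric]) (auto intro!: arg_cong [of _ _ card])
  have gm: "g m * basis_elt g B = (-1) ^ (card B + card ({m} \<inter> B)) *\<^sub>R (basis_elt g B * g m)"
    using gen_basis_elt_commute [OF B] insert by auto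
  have "basis_elt g (insert m A) * basis_elt g B =
      (-1) ^ (card A * card B + card (A \<inter> B)) *\<^sub>R (g m * basis_elt g B * basis_elt g A)"
    by (simp add: bm mult.assoc IH)
  also have "\<dots> = ((-1) ^ (card A * card B + card (A \<inter> B)) * (-1) ^ (card B + card ({m} \<inter> B))) *\<^sub>R
      (basis_elt g B * basis_elt g (insert m A))"
    unfolding gm by (simp add: bm mult.assoc)
  also have "(-1) ^ (card A * card B + card (A \<inter> B)) * (-1) ^ (card B + card ({m} \<inter> B)) =
      ((-1) ^ (card (insert m A) * card B + card (insert m A \<inter> B)) :: real)"
    unfolding c using m insert.hyps(1) by (simp add: power_add [symmetric] algebra_simps)
  finally show ?case .
qed

lemma commutator_basis_elt:
  assumes A: "A \<subseteq> {1..n}" and B: "B \<subseteq> {1..n}"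
  shows "commutator (basis_elt g A) (basis_elt g B) = 0 \<or>
    odd (card A * card B + card (A \<inter> B)) \<and>
    (\<exists>s. commutator (basis_elt g A) (basis_elt g B) = s *\<^sub>R basis_elt g (sdiff A B))"
proof (cases "even (card A * card B + card (A \<inter> B))")
  case True
  then show ?thesis
    using basis_elt_commute [OF _ A B] finite_subset [OF A] by (simp add: commutator_def)
next
  case False
  obtain s where s: "basis_elt g A * basis_elt g B = s *\<^sub>R basis_elt g (sdiff A B)"
    using basis_elt_mult [OF _ A B] finite_subset [OF A] by auto
  obtain t where t: "basis_elt g B * basis_elt g A = t *\<^sub>R basis_elt g (sdiff A B)"
    using basis_elt_mult [OF _ B A] finite_subset [OF B] by (auto simp: sdiff_commute)
  show ?thesis
    using False unfolding commutator_def s t scaleR_diff_left [symmetric] by blast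
qed

section \<open>Sums of spaces of fixed ranks\<close>

text \<open>Describing rank sums by subsets of one basis turns sums and intersections of spaces into
  unions and intersections of rank sets.\<close>

definition rank_basis :: "nat set \<Rightarrow> 'a set" where
  "rank_basis K = basis_elt g ` {A. A \<subseteq> {1..n} \<and> card A \<in> K}"

lemma rank_basis_Un: "rank_basis (K \<union> L) = rank_basis K \<union> rank_basis L"
  by (auto simp: rank_basis_def)

lemma rank_basis_subset: "rank_basis K \<subseteq> basis_elt g ` Pow {1..n}"
  by (auto simp: rank_basis_def)

lemma rank_basis_Int: "rank_basis K \<inter> rank_basis L = rank_basis (K \<inter> L)"
proof -
  have "inj_on (basis_elt g) (Pow {1..n})"
    using gens unfolding clifford_generators_def n_def by blast
  then show ?thesis
    unfolding rank_basis_def by (subst inj_on_image_Int [symmetric]) (auto intro!: image_cong)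
qed

lemma independent_rank_basis: "independent (rank_basis K)"
proof -
  have "independent (basis_elt g ` Pow {1..n})"
    using gens unfolding clifford_generators_def n_def by blast
  then show ?thesis
    using rank_basis_subset by (rule real_vector.independent_mono)
qed

lemma span_plus: "span S + span T = span (S \<union> T :: 'a set)"
  by (auto simp: span_Un set_plus_def)

lemma rank_sum_eq_span: "finite K \<Longrightarrow> rank_sum n g K = span (rank_basis K)"
proof (induction K rule: finite_induct)
  case empty
  then show ?case by (simp add: rank_sum_def rank_basis_def)
next
  case (insert k K)
  have "rank_space n g k = span (rank_basis {k})"
    by (simp add: rank_space_def rank_basis_def)
  then show ?case
    using insert rank_basis_Un [of "{k}" K] by (simp add: rank_sum_def span_plus)
qed

lemma rank_space_eq_rank_sum: "rank_space n g k = rank_sum n g {k}"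
  by (simp add: rank_sum_def)

lemma rank_sum_plus:
  "finite K \<Longrightarrow> finite L \<Longrightarrow> rank_sum n g K + rank_sum n g L = rank_sum n g (K \<union> L)"
  by (simp add: rank_sum_eq_span span_plus rank_basis_Un)

text \<open>Coordinates in the basis for \<open>K \<union> L\<close> agree with those in either
  smaller basis, so every basis element with a nonzero coefficient belongs to both.\<close>

lemma rank_sum_Int:
  assumes "finite K" "finite L"
  shows "rank_sum n g K \<inter> rank_sum n g L = rank_sum n g (K \<inter> L)"
proof
  show "rank_sum n g (K \<inter> L) \<subseteq> rank_sum n g K \<inter> rank_sum n g L"
    using assms by (simp add: rank_sum_eq_span rank_basis_Int [symmetric] span_mono)
  show "rank_sum n g K \<inter> rank_sum n g L \<subseteq> rank_sum n g (K \<inter> L)"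
  proof
    fix x assume x: "x \<in> rank_sum n g K \<inter> rank_sum n g L"
    let ?B = "rank_basis (K \<union> L)"
    have xK: "x \<in> span (rank_basis K)" and xL: "x \<in> span (rank_basis L)"
      using x assms by (auto simp: rank_sum_eq_span)
    have xB: "x \<in> span ?B"
      using xK span_mono [of "rank_basis K" ?B] by (auto simp: rank_basis_Un)
    have "representation ?B x = representation (rank_basis K) x"
      by (rule real_vector.representation_extend [OF independent_rank_basis xK]) (simp add: rank_basis_Un)
    moreover have "representation ?B x = representation (rank_basis L) x"
      by (rule real_vector.representation_extend [OF independent_rank_basis xL]) (simp add: rank_basis_Un)
    ultimately have "b \<in> rank_basis (K \<inter> L)" if "representation ?B x b \<noteq> 0" for b
      using that real_vector.representation_ne_zero [of "rank_basis K" x b]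
        real_vector.representation_ne_zero [of "rank_basis L" x b]
      unfolding rank_basis_Int [symmetric] by simp
    then have "(\<Sum>b | representation ?B x b \<noteq> 0. representation ?B x b *\<^sub>R b) \<in> span (rank_basis (K \<inter> L))"
      by (intro span_sum span_scale span_base) auto
    also have "(\<Sum>b | representation ?B x b \<noteq> 0. representation ?B x b *\<^sub>R b) = x"
      by (rule real_vector.sum_nonzero_representation_eq [OF independent_rank_basis xB])
    finally show "x \<in> rank_sum n g (K \<inter> L)"
      using assms by (simp add: rank_sum_eq_span)
  qed
qed

lemma rank_sum_empty [simp]: "rank_sum n g {} = {0}"
  by (simp add: rank_sum_def)

lemma rank_sum_mono: "finite L \<Longrightarrow> K \<subseteq> L \<Longrightarrow> rank_sum n g K \<subseteq> rank_sum n g L"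
  using rank_sum_Int [of K L] by (auto simp: inf.absorb1 dest: finite_subset)

lemma rank_space_nontrivial:
  assumes "k \<le> n" shows "rank_space n g k \<noteq> {0}"
proof
  assume "rank_space n g k = {0}"
  then have "basis_elt g {1..k} = 0"
    using assms span_base [of "basis_elt g {1..k}" "rank_basis {k}"]
    by (auto simp: rank_space_def rank_basis_def)
  then have "0 \<in> rank_basis {k}"
    using assms by (force simp: rank_basis_def)
  then show False
    using independent_rank_basis real_vector.dependent_zero by blast
qed

text \<open>A rank missing from \<open>L\<close> would give a nonzero rank space meeting
  \<open>rank_sum n g L\<close> only in 0. This turns the condition in
  \<open>listed_lie_subalgebra\<close> that a space consist of even ranks into one on its set of
  ranks.\<close>

lemma rank_sum_subset_imp:
  assumes "finite K" "finite L" "K \<subseteq> {..n}" "rank_sum n g K \<subseteq> rank_sum n g L"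
  shows "K \<subseteq> L"
proof
  fix k assume k: "k \<in> K"
  have "rank_sum n g {k} \<subseteq> rank_sum n g L"
    using rank_sum_mono [of K "{k}"] assms k by auto
  then have "rank_sum n g {k} = rank_sum n g ({k} \<inter> L)"
    using rank_sum_Int [of "{k}" L] assms(2) by auto
  moreover have "rank_sum n g {k} \<noteq> {0}"
    using rank_space_nontrivial [of k] assms(3) k by (auto simp: rank_space_eq_rank_sum)
  ultimately show "k \<in> L"
    by (metis Int_insert_left_if0 Int_empty_left rank_sum_empty)
qed

text \<open>Each summand is minus the sum of the others, so it lies in two rank sums with disjoint
  sets of ranks.\<close>

lemma direct_family_rank_space: "direct_family {0..n} (rank_space n g)"
  unfolding direct_family_def
proof (intro allI impI ballI)
  fix w i
  assume w: "(\<forall>i\<in>{0..n}. w i \<in> rank_space n g i) \<and> (\<Sum>i\<in>{0..n}. w i) = 0" and i: "i \<in> {0..n}"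
  let ?L = "{0..n} - {i}"
  have "w j \<in> span (rank_basis ?L)" if "j \<in> ?L" for j
    using w that rank_sum_mono [of ?L "{j}"] by (auto simp: rank_space_eq_rank_sum rank_sum_eq_span)
  then have "(\<Sum>j\<in>?L. w j) \<in> span (rank_basis ?L)"
    by (rule span_sum)
  moreover have "w i = - (\<Sum>j\<in>?L. w j)"
    using w i by (simp add: sum.remove [of _ i] eq_neg_iff_add_eq_0)
  ultimately have "w i \<in> rank_sum n g ?L"
    by (simp add: rank_sum_eq_span span_neg)
  moreover have "w i \<in> rank_sum n g {i}"
    using w i by (auto simp: rank_space_eq_rank_sum)
  ultimately have "w i \<in> rank_sum n g ({i} \<inter> ?L)"
    using rank_sum_Int [of "{i}" ?L] by auto
  then show "w i = 0" by simp
qed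

section \<open>Lie algebras from sets of ranks\<close>

text \<open>The number \<open>i\<close> stands for \<open>card (A \<inter> B)\<close>, and the last condition for the oddness of \<open>a * b + i\<close>.\<close>

definition bracket_closed :: "nat set \<Rightarrow> bool" where
  "bracket_closed K \<longleftrightarrow> (\<forall>a\<in>K. \<forall>b\<in>K. \<forall>i. i \<le> a \<longrightarrow> i \<le> b \<longrightarrow> a + b \<le> n + i \<longrightarrow>
     ((odd a \<and> odd b) \<noteq> odd i) \<longrightarrow> a + b - 2 * i \<in> K)"

lemma commutator_in_span:
  assumes "\<And>x y. x \<in> S \<Longrightarrow> y \<in> S \<Longrightarrow> commutator x y \<in> span S"
    and U: "U \<in> span S" and V: "V \<in> span S"
  shows "commutator U V \<in> span (S :: 'a set)"
proof -
  have *: "commutator x V \<in> span S" if "x \<in> S" for x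
    using V
  proof (induction rule: span_induct_alt)
    case base
    show ?case by (simp add: commutator_def span_zero)
  next
    case (step c y z)
    have "commutator x (c *\<^sub>R y + z) = c *\<^sub>R commutator x y + commutator x z"
      by (simp add: commutator_def algebra_simps)
    then show ?case using step that assms(1) by (simp add: span_add span_scale)
  qed
  from U show ?thesis
  proof (induction rule: span_induct_alt)
    case base
    show ?case by (simp add: commutator_def span_zero)
  next
    case (step c y z)
    have "commutator (c *\<^sub>R y + z) V = c *\<^sub>R commutator y V + commutator z V"
      by (simp add: commutator_def algebra_simps)
    then show ?case using step * by (simp add: span_add span_scale)
  qed
qed

lemma commutator_rank_basis:
  assumes K: "bracket_closed K" and "x \<in> rank_basis K" "y \<in> rank_basis K"
  shows "commutator x y \<in> span (rank_basis K)"
proof -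
  obtain A B where A: "A \<subseteq> {1..n}" "card A \<in> K" "x = basis_elt g A"
    and B: "B \<subseteq> {1..n}" "card B \<in> K" "y = basis_elt g B"
    using assms(2,3) by (auto simp: rank_basis_def)
  have fin: "finite A" "finite B" using A B finite_subset by auto
  from commutator_basis_elt [OF A(1) B(1)] show ?thesis
  proof (elim disjE conjE exE)
    assume "commutator (basis_elt g A) (basis_elt g B) = 0"
    then show ?thesis by (simp add: A B span_zero)
  next
    fix s
    assume odd: "odd (card A * card B + card (A \<inter> B))"
      and s: "commutator (basis_elt g A) (basis_elt g B) = s *\<^sub>R basis_elt g (sdiff A B)"
    \<comment> \<open>Only \<open>n\<close> indices are available; this supplies the condition
      \<open>a + b \<le> n + i\<close> of \<open>bracket_closed\<close>.\<close>
    have "card (A \<union> B) \<le> n"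
      using A B card_mono [of "{1..n}" "A \<union> B"] by auto
    then have "card A + card B \<le> n + card (A \<inter> B)"
      using card_Un_Int [OF fin] by simp
    then have "card (sdiff A B) \<in> K"
      using K [unfolded bracket_closed_def, rule_format, of "card A" "card B" "card (A \<inter> B)"]
        A(2) B(2) odd card_mono [OF fin(1), of "A \<inter> B"] card_mono [OF fin(2), of "A \<inter> B"]
      unfolding card_sdiff [OF fin] by auto
    then have "basis_elt g (sdiff A B) \<in> rank_basis K"
      using A B by (auto simp: rank_basis_def sdiff_def)
    then show ?thesis by (simp add: A B s span_scale span_base)
  qed
qed

lemma lie_subalgebra_rank_sum:
  assumes "finite K" "bracket_closed K"
  shows "lie_subalgebra n g (rank_sum n g K)"
proof -
  have "commutator U V \<in> span (rank_basis K)" if "U \<in> span (rank_basis K)" "V \<in> span (rank_basis K)" for U V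
    using commutator_in_span [OF commutator_rank_basis that] assms by blast
  moreover have "span (rank_basis K) \<subseteq> clifford_algebra n g"
    unfolding clifford_algebra_def by (rule span_mono [OF rank_basis_subset])
  ultimately show ?thesis
    unfolding lie_subalgebra_def lie_algebra_on_def rank_sum_eq_span [OF assms(1)]
    by (auto simp: commutator_def algebra_simps)
qed

text \<open>With an entry of rank 0 the overlap is 0, and the parity condition fails.\<close>

lemma bracket_closed_insert_0: "bracket_closed K \<Longrightarrow> bracket_closed (insert 0 K)"
  unfolding bracket_closed_def by fastforce

text \<open>The full index set contains every other, so the overlap equals the other rank; the
  parity condition then fails if \<open>n\<close> is odd or the other rank is even.\<close>

lemma bracket_closed_insert_n:
  assumes K: "bracket_closed K" and n: "odd n \<or> K \<subseteq> Collect even" and "K \<subseteq> {..n}"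
  shows "bracket_closed (insert n K)"
  unfolding bracket_closed_def
proof (intro ballI allI impI)
  fix a b i
  assume ab: "a \<in> insert n K" "b \<in> insert n K" "i \<le> a" "i \<le> b" "a + b \<le> n + i"
    and odd: "(odd a \<and> odd b) \<noteq> odd i"
  have "a \<noteq> n"
  proof
    assume "a = n"
    with ab have "i = b" by simp
    then show False using odd n \<open>a = n\<close> ab(2) by auto
  qed
  moreover have "b \<noteq> n"
  proof
    assume "b = n"
    with ab have "i = a" by simp
    then show False using odd n \<open>b = n\<close> ab(1) by auto
  qed
  ultimately show "a + b - 2 * i \<in> insert n K"
    using K ab odd unfolding bracket_closed_def by auto
qed

lemma lie_extension_rank_sum:
  assumes "finite K" "bracket_closed (insert k K)"
  shows "lie_extension n g (rank_sum n g K) (rank_space n g k)"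
  unfolding lie_extension_def rank_space_eq_rank_sum
proof
  show "lie_subalgebra n g (rank_sum n g K + rank_sum n g {k})"
    using assms lie_subalgebra_rank_sum [of "insert k K"] by (simp add: rank_sum_plus)
  show "rank_sum n g {k} \<subseteq> rank_sum n g K \<or> rank_sum n g K \<inter> rank_sum n g {k} = {0}"
    using assms(1) rank_sum_mono [of K "{k}"] by (cases "k \<in> K") (auto simp: rank_sum_Int)
qed

text \<open>Elements of rank 0, and of rank \<open>n\<close> under the stated parities, create no
  new brackets, so every claim about a listed space reduces to
  \<open>bracket_closed K\<close>.\<close>

lemma listed_rank_sum:
  assumes K: "K \<subseteq> {..n}" "bracket_closed K"
  shows "listed_lie_subalgebra n g (rank_sum n g K)"
proof -
  have fin: "finite K" using K(1) finite_subset by blast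
  have "K \<subseteq> {j. j \<le> n \<and> even j}" if "rank_sum n g K \<subseteq> rank_sum n g {j. j \<le> n \<and> even j}"
    by (rule rank_sum_subset_imp [OF fin _ K(1) that]) simp
  then show ?thesis
    unfolding listed_lie_subalgebra_def
    by (intro conjI impI lie_subalgebra_rank_sum lie_extension_rank_sum fin K
        bracket_closed_insert_0 bracket_closed_insert_n) auto
qed

lemma eq_up_to_0_n_rank_sum:
  assumes "finite K" "finite L" "K \<union> {0, n} = L \<union> {0, n}"
  shows "eq_up_to_0_n n g (rank_sum n g K) (rank_sum n g L)"
  using assms unfolding eq_up_to_0_n_def
  by (simp add: rank_space_eq_rank_sum rank_sum_plus insert_commute)

lemma quaternion_type_plus:
  "quaternion_type n g k + quaternion_type n g l = rank_sum n g {j. j \<le> n \<and> j mod 4 \<in> {k mod 4, l mod 4}}"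
  unfolding quaternion_type_def by (subst rank_sum_plus) (auto intro!: arg_cong [of _ _ "rank_sum n g"])


text \<open>Two facts come for free: rank 0 needs equal index sets, which fail the parity condition,
  and rank \<open>n\<close> needs disjoint index sets that cover all indices, both of odd size.
  Naming the rank \<open>c\<close> avoids truncated subtraction.\<close>

lemma bracket_closedI:
  assumes "\<And>a b c i. a \<in> K \<Longrightarrow> b \<in> K \<Longrightarrow> i \<le> a \<Longrightarrow> i \<le> b \<Longrightarrow> c + i \<le> n \<Longrightarrow> c + 2 * i = a + b \<Longrightarrow>
     odd a \<and> odd b \<longleftrightarrow> even i \<Longrightarrow> 1 \<le> c \<Longrightarrow> c \<le> n \<Longrightarrow> (c = n \<Longrightarrow> even n \<and> odd a \<and> odd b) \<Longrightarrow> c \<in> K"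
  shows "bracket_closed K"
  unfolding bracket_closed_def
proof (intro ballI allI impI)
  fix a b i
  assume *: "a \<in> K" "b \<in> K" "i \<le> a" "i \<le> b" "a + b \<le> n + i" "(odd a \<and> odd b) \<noteq> odd i"
  have "1 \<le> a + b - 2 * i"
  proof (rule ccontr)
    assume "\<not> 1 \<le> a + b - 2 * i"
    then have "a = i" "b = i" using * by auto
    then show False using * by auto
  qed
  moreover have "even n \<and> odd a \<and> odd b" if "a + b - 2 * i = n"
  proof -
    have "i = 0" "n = a + b" using * that by auto
    then show ?thesis using * by auto
  qed
  ultimately show "a + b - 2 * i \<in> K"
    by - (rule assms [of a b i], use * in auto)
qed

section \<open>Closed sets of ranks\<close>

lemma bracket_closed_small_ranks:
  "bracket_closed {0}" "bracket_closed {n}" "bracket_closed {2}"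
  by (rule bracket_closedI; force simp: le_Suc_eq numeral_2_eq_2)+

text \<open>Rank 0 never arises from a commutator, and rank \<open>n\<close> only for even
  \<open>n\<close>.\<close>

lemma bracket_closed_interval:
  "even n \<Longrightarrow> bracket_closed {1..n}" "odd n \<Longrightarrow> bracket_closed {1..n - 1}"
  by (rule bracket_closedI; force)+

text \<open>Brackets with rank 1 or 2 follow \<open>bracket_low_ranks\<close>, those of two ranks
  near \<open>n\<close> follow \<open>bracket_large_ranks\<close>. In the last two claims the parity
  of \<open>n\<close> makes \<open>m\<close> odd, so bracketing with rank 1 exchanges
  \<open>m\<close> and \<open>m + 1\<close>.\<close>

lemma bracket_closed_top_ranks:
  "bracket_closed {1, 2}"
  "n = m + 1 \<Longrightarrow> bracket_closed {2, m}"
  "n = m + 2 \<Longrightarrow> bracket_closed {2, m}"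
  "n = m + 2 \<Longrightarrow> odd n \<Longrightarrow> bracket_closed {1, 2, m, m + 1}"
  "n = m + 1 \<Longrightarrow> even n \<Longrightarrow> bracket_closed {1, 2, m, m + 1}"
proof -
  show "bracket_closed {1, 2}"
  proof (rule bracket_closedI)
    fix a b c i :: nat
    assume ab: "a \<in> {1, 2}" "b \<in> {1, 2}"
      and i: "i \<le> a" "i \<le> b" "c + 2 * i = a + b" "odd a \<and> odd b \<longleftrightarrow> even i"
    show "c \<in> {1, 2}"
      using ab by (elim insertE emptyE) (use bracket_low_ranks [OF i] in simp_all)
  qed
  show "bracket_closed {2, m}" if n: "n = m + 1"
  proof (rule bracket_closedI)
    fix a b c i
    assume ab: "a \<in> {2, m}" "b \<in> {2, m}"
      and i: "i \<le> a" "i \<le> b" "c + 2 * i = a + b" "odd a \<and> odd b \<longleftrightarrow> even i" and c: "c + i \<le> n" "1 \<le> c"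
    note facts = bracket_low_ranks [OF i] bracket_large_ranks [OF c(1) i(3) c(2) i(4)]
    show "c \<in> {2, m}"
      using ab by (elim insertE emptyE) (use n facts in simp_all)
  qed
  show "bracket_closed {2, m}" if n: "n = m + 2"
  proof (rule bracket_closedI)
    fix a b c i
    assume ab: "a \<in> {2, m}" "b \<in> {2, m}"
      and i: "i \<le> a" "i \<le> b" "c + 2 * i = a + b" "odd a \<and> odd b \<longleftrightarrow> even i" and c: "c + i \<le> n" "1 \<le> c"
    note facts = bracket_low_ranks [OF i] bracket_large_ranks [OF c(1) i(3) c(2) i(4)]
    show "c \<in> {2, m}"
      using ab by (elim insertE emptyE) (use n facts in simp_all)
  qed
  show "bracket_closed {1, 2, m, m + 1}" if n: "n = m + 2" "odd n"
  proof (rule bracket_closedI)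
    fix a b c i
    assume ab: "a \<in> {1, 2, m, m + 1}" "b \<in> {1, 2, m, m + 1}"
      and i: "i \<le> a" "i \<le> b" "c + 2 * i = a + b" "odd a \<and> odd b \<longleftrightarrow> even i" and c: "c + i \<le> n" "1 \<le> c"
    note facts = bracket_low_ranks [OF i] bracket_large_ranks [OF c(1) i(3) c(2) i(4)]
    show "c \<in> {1, 2, m, m + 1}"
      using ab by (elim insertE emptyE) (use n facts in simp_all)
  qed
  show "bracket_closed {1, 2, m, m + 1}" if n: "n = m + 1" "even n"
  proof (rule bracket_closedI)
    fix a b c i
    assume ab: "a \<in> {1, 2, m, m + 1}" "b \<in> {1, 2, m, m + 1}"
      and i: "i \<le> a" "i \<le> b" "c + 2 * i = a + b" "odd a \<and> odd b \<longleftrightarrow> even i" and c: "c + i \<le> n" "1 \<le> c"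
    note facts = bracket_low_ranks [OF i] bracket_large_ranks [OF c(1) i(3) c(2) i(4)]
    show "c \<in> {1, 2, m, m + 1}"
      using ab by (elim insertE emptyE) (use n facts in simp_all)
  qed
qed

text \<open>\<open>res\<close> keeps commutators in the class and \<open>top\<close> keeps them
  below the cut-off \<open>k\<close>. The oddness of \<open>a\<close> is passed to
  \<open>top\<close> so that classes of even ranks can rule out \<open>c = n\<close>.\<close>

lemma bracket_closed_residues:
  assumes res: "\<And>a b c i. P a \<Longrightarrow> P b \<Longrightarrow> c + 2 * i = a + b \<Longrightarrow> odd a \<and> odd b \<longleftrightarrow> even i \<Longrightarrow> P c"
    and top: "\<And>a c. P a \<Longrightarrow> P c \<Longrightarrow> c \<le> n \<Longrightarrow> (c = n \<Longrightarrow> even n \<and> odd a) \<Longrightarrow> c \<le> k"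
  shows "bracket_closed {j. 1 \<le> j \<and> j \<le> k \<and> P j}"
proof (rule bracket_closedI)
  fix a b c i
  assume *: "a \<in> {j. 1 \<le> j \<and> j \<le> k \<and> P j}" "b \<in> {j. 1 \<le> j \<and> j \<le> k \<and> P j}"
    "c + 2 * i = a + b" "odd a \<and> odd b \<longleftrightarrow> even i" "1 \<le> c" "c \<le> n" "c = n \<Longrightarrow> even n \<and> odd a \<and> odd b"
  have "P c" using res [of a b c i] * by simp
  moreover have "c \<le> k" using top [of a c] * \<open>P c\<close> by simp
  ultimately show "c \<in> {j. 1 \<le> j \<and> j \<le> k \<and> P j}" using * by simp
qed

lemma listed_rank_sum_residues:
  assumes "k \<le> n"
    and "\<And>a b c i. P a \<Longrightarrow> P b \<Longrightarrow> c + 2 * i = a + b \<Longrightarrow> odd a \<and> odd b \<longleftrightarrow> even i \<Longrightarrow> P c"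
    and "\<And>a c. P a \<Longrightarrow> P c \<Longrightarrow> c \<le> n \<Longrightarrow> (c = n \<Longrightarrow> even n \<and> odd a) \<Longrightarrow> c \<le> k"
  shows "listed_lie_subalgebra n g (rank_sum n g {j. 1 \<le> j \<and> j \<le> k \<and> P j})"
proof (rule listed_rank_sum)
  show "{j. 1 \<le> j \<and> j \<le> k \<and> P j} \<subseteq> {..n}" using assms(1) by auto
  show "bracket_closed {j. 1 \<le> j \<and> j \<le> k \<and> P j}" by (rule bracket_closed_residues) fact+
qed

text \<open>Only the ranks 0 and \<open>n\<close> can be missing from the truncated sum, and they
  are added on both sides.\<close>

lemma eq_up_to_0_n_residues:
  assumes "k \<le> n" "\<And>j. P j \<Longrightarrow> j \<le> n \<Longrightarrow> j \<noteq> n \<Longrightarrow> j \<le> k"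
  shows "eq_up_to_0_n n g (rank_sum n g {j. 1 \<le> j \<and> j \<le> k \<and> P j}) (rank_sum n g {j. j \<le> n \<and> P j})"
proof (rule eq_up_to_0_n_rank_sum)
  show "{j. 1 \<le> j \<and> j \<le> k \<and> P j} \<union> {0, n} = {j. j \<le> n \<and> P j} \<union> {0, n}"
    using assms by (auto simp: Suc_le_eq)
qed auto

section \<open>Sums over residue classes of ranks\<close>

lemma ranks_23:
  assumes k: "last_rank_23 n k" and S: "S = rank_sum n g {j. 1 \<le> j \<and> j \<le> k \<and> j mod 4 \<in> {2, 3}}"
  shows "listed_lie_subalgebra n g S"
    and "eq_up_to_0_n n g S (quaternion_type n g 2 + quaternion_type n g 3)"
    and "n \<in> {2, 3} \<Longrightarrow> S = rank_space n g 2"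
    and "n = 4 \<Longrightarrow> S = rank_sum n g {2, n - 1}"
    and "n = 5 \<Longrightarrow> S = rank_sum n g {2, n - 2}"
proof -
  have kn: "k \<le> n" using last_rank_le(1) [OF k] by simp
  show "listed_lie_subalgebra n g S"
    unfolding S
  proof (rule listed_rank_sum_residues [OF kn])
    fix a b c i :: nat
    assume "a mod 4 \<in> {2, 3}" "b mod 4 \<in> {2, 3}" "c + 2 * i = a + b" "odd a \<and> odd b \<longleftrightarrow> even i"
    then show "c mod 4 \<in> {2, 3}" using residues_closed [of c i a b "{2, 3}"] by simp
  qed (use last_rank_23_max [OF k] in \<open>auto\<close>)
  show "eq_up_to_0_n n g S (quaternion_type n g 2 + quaternion_type n g 3)"
    using eq_up_to_0_n_residues [of k "\<lambda>j. j mod 4 \<in> {2, 3}", OF kn] last_rank_23_max [OF k]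
    by (simp add: S quaternion_type_plus)
  show "S = rank_space n g 2" if "n \<in> {2, 3}"
  proof -
    \<comment> \<open>For such small \<open>n\<close> the window fixes \<open>k\<close>, and the
      ranks up to \<open>k\<close> can be enumerated.\<close>
    have "k = 2" using k that unfolding last_rank_23_def by auto
    then show ?thesis
      using that unfolding S rank_space_eq_rank_sum
      \<comment> \<open>Without \<open>set_filter\<close> and \<open>set_upt\<close> the list is
        evaluated entry by entry instead of becoming a set comprehension again.\<close>
      by (subst ranks_eq_set_filter) (auto simp: upt_rec_numeral simp del: set_filter set_upt)
  qed
  show "S = rank_sum n g {2, n - 1}" if "n = 4"
  proof -
    have "k = 3" using k that unfolding last_rank_23_def by auto
    then show ?thesis
      using that unfolding S rank_space_eq_rank_sum
      by (subst ranks_eq_set_filter) (auto simp: upt_rec_numeral simp del: set_filter set_upt)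
  qed
  show "S = rank_sum n g {2, n - 2}" if "n = 5"
  proof -
    have "k = 3" using k that unfolding last_rank_23_def by auto
    then show ?thesis
      using that unfolding S rank_space_eq_rank_sum
      by (subst ranks_eq_set_filter) (auto simp: upt_rec_numeral simp del: set_filter set_upt)
  qed
qed

lemma ranks_02:
  assumes k: "last_rank_02 n k" and S: "S = rank_sum n g {j. 1 \<le> j \<and> j \<le> k \<and> even j}"
  shows "listed_lie_subalgebra n g S"
    and "eq_up_to_0_n n g S (quaternion_type n g 0 + quaternion_type n g 2)"
    and "n \<in> {3, 4} \<Longrightarrow> S = rank_space n g 2"
    and "n = 5 \<Longrightarrow> S = rank_sum n g {2, n - 1}"
    and "n = 6 \<Longrightarrow> S = rank_sum n g {2, n - 2}"
proof -
  have kn: "k \<le> n" using last_rank_le(2) [OF k] by simp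
  show "listed_lie_subalgebra n g S"
    unfolding S
  proof (rule listed_rank_sum_residues [OF kn])
    fix a b c i :: nat
    assume "even a" "even b" "c + 2 * i = a + b"
    then have "even (c + 2 * i)" by simp
    then show "even c" by simp
  \<comment> \<open>The cut-off: \<open>c = n\<close> would force an odd entry, and all ranks in
    play are even.\<close>
  qed (use last_rank_02_max [OF k] in \<open>auto\<close>)
  show "eq_up_to_0_n n g S (quaternion_type n g 0 + quaternion_type n g 2)"
    using eq_up_to_0_n_residues [of k even, OF kn] last_rank_02_max [OF k]
    by (simp add: S quaternion_type_plus even_iff_mod_4)
  show "S = rank_space n g 2" if "n \<in> {3, 4}"
  proof -
    have "k = 2" using k that unfolding last_rank_02_def by auto
    then show ?thesis
      using that unfolding S rank_space_eq_rank_sum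
      by (subst ranks_eq_set_filter) (auto simp: upt_rec_numeral simp del: set_filter set_upt)
  qed
  show "S = rank_sum n g {2, n - 1}" if "n = 5"
  proof -
    have "k = 4" using k that unfolding last_rank_02_def by auto
    then show ?thesis
      using that unfolding S rank_space_eq_rank_sum
      by (subst ranks_eq_set_filter) (auto simp: upt_rec_numeral simp del: set_filter set_upt)
  qed
  show "S = rank_sum n g {2, n - 2}" if "n = 6"
  proof -
    have "k = 4" using k that unfolding last_rank_02_def by auto
    then show ?thesis
      using that unfolding S rank_space_eq_rank_sum
      by (subst ranks_eq_set_filter) (auto simp: upt_rec_numeral simp del: set_filter set_upt)
  qed
qed

lemma ranks_12:
  assumes k: "last_rank_12 n k" and S: "S = rank_sum n g {j. 1 \<le> j \<and> j \<le> k \<and> j mod 4 \<in> {1, 2}}"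
  shows "listed_lie_subalgebra n g S"
    and "eq_up_to_0_n n g S (quaternion_type n g 1 + quaternion_type n g 2)"
    and "n \<in> {2, 3, 4, 5} \<Longrightarrow> S = rank_sum n g {1, 2}"
    and "n = 6 \<Longrightarrow> S = rank_sum n g {1, 2, n - 1, n}"
    and "n = 7 \<Longrightarrow> S = rank_sum n g {1, 2, n - 2, n - 1}"
proof -
  have kn: "k \<le> n" using last_rank_le(3) [OF k] by simp
  show "listed_lie_subalgebra n g S"
    unfolding S
  proof (rule listed_rank_sum_residues [OF kn])
    fix a b c i :: nat
    assume "a mod 4 \<in> {1, 2}" "b mod 4 \<in> {1, 2}" "c + 2 * i = a + b" "odd a \<and> odd b \<longleftrightarrow> even i"
    then show "c mod 4 \<in> {1, 2}" using residues_closed [of c i a b "{1, 2}"] by simp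
  qed (use last_rank_12_max [OF k] in \<open>auto\<close>)
  show "eq_up_to_0_n n g S (quaternion_type n g 1 + quaternion_type n g 2)"
    using eq_up_to_0_n_residues [of k "\<lambda>j. j mod 4 \<in> {1, 2}", OF kn] last_rank_12_max [OF k]
    by (simp add: S quaternion_type_plus)
  show "S = rank_sum n g {1, 2}" if "n \<in> {2, 3, 4, 5}"
  proof -
    have "k = 2" using k that unfolding last_rank_12_def by auto
    then show ?thesis
      using that unfolding S rank_space_eq_rank_sum
      by (subst ranks_eq_set_filter) (auto simp: upt_rec_numeral simp del: set_filter set_upt)
  qed
  show "S = rank_sum n g {1, 2, n - 1, n}" if "n = 6"
  proof -
    have "k = 6" using k that unfolding last_rank_12_def by auto
    then show ?thesis
      using that unfolding S rank_space_eq_rank_sum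
      by (subst ranks_eq_set_filter) (auto simp: upt_rec_numeral simp del: set_filter set_upt)
  qed
  show "S = rank_sum n g {1, 2, n - 2, n - 1}" if "n = 7"
  proof -
    have "k = 6" using k that unfolding last_rank_12_def by auto
    then show ?thesis
      using that unfolding S rank_space_eq_rank_sum
      by (subst ranks_eq_set_filter) (auto simp: upt_rec_numeral simp del: set_filter set_upt)
  qed
qed

lemma ranks_2:
  assumes k: "last_rank_2 n k" and S: "S = rank_sum n g {j. 1 \<le> j \<and> j \<le> k \<and> j mod 4 = 2}"
  shows "listed_lie_subalgebra n g S"
    and "eq_up_to_0_n n g S (quaternion_type n g 2)"
    and "n \<in> {3, 4, 5, 6} \<Longrightarrow> S = rank_space n g 2"
    and "n = 7 \<Longrightarrow> S = rank_sum n g {2, n - 1}"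
    and "n = 8 \<Longrightarrow> S = rank_sum n g {2, n - 2}"
proof -
  have kn: "k \<le> n" using last_rank_le(4) [OF k] by simp
  show "listed_lie_subalgebra n g S"
    unfolding S
  proof (rule listed_rank_sum_residues [OF kn])
    fix a b c i :: nat
    assume "a mod 4 = 2" "b mod 4 = 2" "c + 2 * i = a + b" "odd a \<and> odd b \<longleftrightarrow> even i"
    then show "c mod 4 = 2" using residues_closed [of c i a b "{2}"] by simp
  qed (use last_rank_2_max [OF k] in \<open>auto simp: even_iff_mod_4\<close>)
  show "eq_up_to_0_n n g S (quaternion_type n g 2)"
    using eq_up_to_0_n_residues [of k "\<lambda>j. j mod 4 = 2", OF kn] last_rank_2_max [OF k]
    by (simp add: S quaternion_type_def)
  show "S = rank_space n g 2" if "n \<in> {3, 4, 5, 6}"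
  proof -
    have "k = 2" using k that unfolding last_rank_2_def by auto
    then show ?thesis
      using that unfolding S rank_space_eq_rank_sum
      by (subst ranks_eq_set_filter) (auto simp: upt_rec_numeral simp del: set_filter set_upt)
  qed
  show "S = rank_sum n g {2, n - 1}" if "n = 7"
  proof -
    have "k = 6" using k that unfolding last_rank_2_def by auto
    then show ?thesis
      using that unfolding S rank_space_eq_rank_sum
      by (subst ranks_eq_set_filter) (auto simp: upt_rec_numeral simp del: set_filter set_upt)
  qed
  show "S = rank_sum n g {2, n - 2}" if "n = 8"
  proof -
    have "k = 6" using k that unfolding last_rank_2_def by auto
    then show ?thesis
      using that unfolding S rank_space_eq_rank_sum
      by (subst ranks_eq_set_filter) (auto simp: upt_rec_numeral simp del: set_filter set_upt)
  qed
qed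

section \<open>Low ranks, intervals and ranks near \<open>n\<close>\<close>

lemma listed_low_ranks:
  shows "listed_lie_subalgebra n g (rank_space n g 0)"
    and "listed_lie_subalgebra n g (rank_space n g n)"
    and "n \<ge> 2 \<Longrightarrow> listed_lie_subalgebra n g (rank_space n g 2)"
    and "n \<ge> 2 \<Longrightarrow> listed_lie_subalgebra n g (rank_sum n g {1, 2})"
  unfolding rank_space_eq_rank_sum
  by (rule listed_rank_sum; simp add: bracket_closed_small_ranks bracket_closed_top_ranks [simplified])+

lemma listed_intervals:
  shows "even n \<Longrightarrow> listed_lie_subalgebra n g (rank_sum n g {1..n})"
    and "odd n \<Longrightarrow> listed_lie_subalgebra n g (rank_sum n g {1..n - 1})"
  by (rule listed_rank_sum; force simp: bracket_closed_interval [simplified])+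

lemma listed_top_ranks:
  assumes "n \<ge> 2"
  shows "listed_lie_subalgebra n g (rank_sum n g {2, n - 1})"
    and "listed_lie_subalgebra n g (rank_sum n g {2, n - 2})"
    and "odd n \<Longrightarrow> listed_lie_subalgebra n g (rank_sum n g {1, 2, n - 2, n - 1})"
    and "even n \<Longrightarrow> listed_lie_subalgebra n g (rank_sum n g {1, 2, n - 1, n})"
proof -
  have eq: "n - 2 + 1 = n - 1" "n - 1 + 1 = n" using assms by simp_all
  \<comment> \<open>The first two entries take \<open>m = n - 1\<close>, the last two
    \<open>m = n - 2\<close>.\<close>
  note closed = bracket_closed_top_ranks(2,5) [of "n - 1"] bracket_closed_top_ranks(3,4) [of "n - 2"]
  show "listed_lie_subalgebra n g (rank_sum n g {2, n - 1})"
    by (rule listed_rank_sum) (use assms closed(1) in auto)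
  show "listed_lie_subalgebra n g (rank_sum n g {2, n - 2})"
    by (rule listed_rank_sum) (use assms closed(3) in auto)
  show "listed_lie_subalgebra n g (rank_sum n g {1, 2, n - 2, n - 1})" if "odd n"
    by (rule listed_rank_sum) (use assms that closed(4) [unfolded eq] in auto)
  show "listed_lie_subalgebra n g (rank_sum n g {1, 2, n - 1, n})" if "even n"
    by (rule listed_rank_sum) (use assms that closed(2) [unfolded eq] in auto)
qed

end

section \<open>The list of Lie subalgebras\<close>

theorem theorem9:
  fixes p q n :: nat and g :: "nat \<Rightarrow> 'a::real_algebra_1"
  assumes "n = p + q" and "n \<ge> 1" and "clifford_generators p q g"
  shows
   "direct_family {0..n} (rank_space n g) \<and>
    \<comment> \<open>1\<close>
    listed_lie_subalgebra n g (rank_space n g 0) \<and>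
    \<comment> \<open>2\<close>
    listed_lie_subalgebra n g (rank_space n g n) \<and>
    \<comment> \<open>3\<close>
    (n \<ge> 2 \<longrightarrow> listed_lie_subalgebra n g (rank_sum n g {1, 2})) \<and>
    \<comment> \<open>4\<close>
    (n \<ge> 3 \<longrightarrow> listed_lie_subalgebra n g (rank_space n g 2)) \<and>
    (n = 2 \<longrightarrow> rank_space n g 2 = rank_space n g n) \<and>
    \<comment> \<open>5\<close>
    (n \<ge> 4 \<and> even n \<longrightarrow> listed_lie_subalgebra n g (rank_sum n g {1..n})) \<and>
    (n \<ge> 4 \<and> odd n \<longrightarrow> listed_lie_subalgebra n g (rank_sum n g {1..n - 1})) \<and>
    (n = 2 \<longrightarrow> rank_sum n g {1..n} = rank_sum n g {1, 2}) \<and>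
    (n = 3 \<longrightarrow> rank_sum n g {1..n - 1} = rank_sum n g {1, 2}) \<and>
    \<comment> \<open>6\<close>
    (n \<ge> 4 \<longrightarrow> listed_lie_subalgebra n g (rank_sum n g {2, n - 1})) \<and>
    \<comment> \<open>7\<close>
    (n \<ge> 5 \<longrightarrow> listed_lie_subalgebra n g (rank_sum n g {2, n - 2})) \<and>
    \<comment> \<open>8\<close>
    (n \<ge> 6 \<and> odd n \<longrightarrow> listed_lie_subalgebra n g (rank_sum n g {1, 2, n - 2, n - 1})) \<and>
    (n \<ge> 6 \<and> even n \<longrightarrow> listed_lie_subalgebra n g (rank_sum n g {1, 2, n - 1, n})) \<and>
    (n = 5 \<longrightarrow> rank_sum n g {1, 2, n - 2, n - 1} = rank_sum n g {1..n - 1}) \<and>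
    \<comment> \<open>9\<close>
    (n \<ge> 2 \<longrightarrow> (\<exists>!k. last_rank_23 n k)) \<and>
    (\<forall>k S. last_rank_23 n k \<and> S = rank_sum n g {j. 1 \<le> j \<and> j \<le> k \<and> j mod 4 \<in> {2, 3}} \<longrightarrow>
       (n \<ge> 6 \<longrightarrow> listed_lie_subalgebra n g S) \<and>
       eq_up_to_0_n n g S (quaternion_type n g 2 + quaternion_type n g 3) \<and>
       (n \<in> {2, 3} \<longrightarrow> S = rank_space n g 2) \<and>
       (n = 4 \<longrightarrow> S = rank_sum n g {2, n - 1}) \<and>
       (n = 5 \<longrightarrow> S = rank_sum n g {2, n - 2})) \<and>
    \<comment> \<open>10\<close>
    (n \<ge> 3 \<longrightarrow> (\<exists>!k. last_rank_02 n k)) \<and>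
    (\<forall>k S. last_rank_02 n k \<and> S = rank_sum n g {j. 1 \<le> j \<and> j \<le> k \<and> even j} \<longrightarrow>
       (n \<ge> 7 \<longrightarrow> listed_lie_subalgebra n g S) \<and>
       eq_up_to_0_n n g S (quaternion_type n g 0 + quaternion_type n g 2) \<and>
       (n \<in> {3, 4} \<longrightarrow> S = rank_space n g 2) \<and>
       (n = 5 \<longrightarrow> S = rank_sum n g {2, n - 1}) \<and>
       (n = 6 \<longrightarrow> S = rank_sum n g {2, n - 2})) \<and>
    \<comment> \<open>11\<close>
    (n \<ge> 2 \<longrightarrow> (\<exists>!k. last_rank_12 n k)) \<and>
    (\<forall>k S. last_rank_12 n k \<and> S = rank_sum n g {j. 1 \<le> j \<and> j \<le> k \<and> j mod 4 \<in> {1, 2}} \<longrightarrow>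
       (n \<ge> 8 \<longrightarrow> listed_lie_subalgebra n g S) \<and>
       eq_up_to_0_n n g S (quaternion_type n g 1 + quaternion_type n g 2) \<and>
       (n \<in> {2, 3, 4, 5} \<longrightarrow> S = rank_sum n g {1, 2}) \<and>
       (n = 6 \<longrightarrow> S = rank_sum n g {1, 2, n - 1, n}) \<and>
       (n = 7 \<longrightarrow> S = rank_sum n g {1, 2, n - 2, n - 1})) \<and>
    \<comment> \<open>12\<close>
    (n \<ge> 3 \<longrightarrow> (\<exists>!k. last_rank_2 n k)) \<and>
    (\<forall>k S. last_rank_2 n k \<and> S = rank_sum n g {j. 1 \<le> j \<and> j \<le> k \<and> j mod 4 = 2} \<longrightarrow>
       (n \<ge> 9 \<longrightarrow> listed_lie_subalgebra n g S) \<and>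
       eq_up_to_0_n n g S (quaternion_type n g 2) \<and>
       (n \<in> {3, 4, 5, 6} \<longrightarrow> S = rank_space n g 2) \<and>
       (n = 7 \<longrightarrow> S = rank_sum n g {2, n - 1}) \<and>
       (n = 8 \<longrightarrow> S = rank_sum n g {2, n - 2}))"
proof -
  interpret clifford p q n g
    using assms by unfold_locales
  \<comment> \<open>These give the coincidences with full intervals of ranks for
    \<open>n = 2\<close>, \<open>n = 3\<close> and \<open>n = 5\<close>.\<close>
  have intervals: "{1..2} = {1, 2::nat}" "{1..4} = {1, 2, 3, 4::nat}"
    by auto
  show ?thesis
    by (intro conjI allI impI; (elim conjE)?)
      ((rule direct_family_rank_space
       | (rule listed_low_ranks; simp) | (rule listed_intervals; assumption) | (rule listed_top_ranks; simp)
       | erule ex1_last_rank_23 | erule ex1_last_rank_02 | erule ex1_last_rank_12 | erule ex1_last_rank_2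
       | (erule (1) ranks_23; assumption) | (erule (1) ranks_02; assumption)
       | (erule (1) ranks_12; assumption) | (erule (1) ranks_2; assumption)
       | (simp add: intervals [simplified]; fail))+)
qed

end
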